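(* Let $f\in L^1(\mathbb{R})\cap L^\infty(\mathbb{R})$ be real-valued. Define formal series of noncommutative symmetric functions by $$R_f = 1+\sum_{\varepsilon\in\mathcal{E}} m_f^{\varepsilon +}\,R_{\varepsilon\bullet},\qquad L_f = 1-\sum_{\varepsilon\in\mathcal{E}} m_f^{\varepsilon -}\,R_{\varepsilon\bullet},\qquad D_f=\sum_{\varepsilon\in\mathcal{E}} d_f^{\varepsilon +}\,R_{\varepsilon\bullet}=-\sum_{\varepsilon\in\mathcal{E}} d_f^{\varepsilon -}\,R_{\varepsilon\bullet}.$$ Then $R_f$ and $L_f$ are grouplike and $D_f$ is primitive.
   Context: Noncommutative symmetric functions: $\mathbf{Sym}$ is the free associative algebra $\mathbb{R}\langle S_1,S_2,\dots\rangle$, graded by $\deg S_n=n$, with coproduct (an algebra morphism) $\Delta S_n=\sum_{k=0}^n S_k\otimes S_{n-k}$, $S_0=1$. Formal series live in its completion for the grading. A series $G$ with constant term $1$ is grouplike if $\Delta G=G\otimes G$; a series $D$ is primitive if $\Delta D=D\otimes 1+1\otimes D$. For a composition $I=(i_1,\dots,i_r)$ of $n$ (finite sequence of positive integers with sum $n$), put $\ell(I)=r$, $S^I=S_{i_1}\cdots S_{i_r}$, $\mathrm{Des}(I)=\{i_1,i_1+i_2,\dots,i_1+\dots+i_{r-1}\}$. For compositions of the same integer, $J\le I$ means $\mathrm{Des}(J)\subseteq \mathrm{Des}(I)$. The ribbon basis $(R_I)$ is defined by $S^I=\sum_{J\le I}R_J$. Signed ribbons: $\mathcal{E}=\bigcup_{n\ge0}\mathcal{E}_n$,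 where $\mathcal{E}_n=\{+,-\}^n$ (so $\mathcal{E}$ contains the empty sequence). For $\varepsilon=(\varepsilon_1,\dots,\varepsilon_{n-1})\in\mathcal{E}_{n-1}$, $n\ge1$, set $R_{\varepsilon\bullet}=(-1)^{\ell(I)-1}R_I$, where $I$ is the composition of $n$ with $\mathrm{Des}(I)=\{i:\varepsilon_i=-\}$ (so $R_{\emptyset\bullet}=R_1$). $\varepsilon+$ and $\varepsilon-$ denote $\varepsilon$ with the indicated sign appended at the end. Weights: $\sigma_+$ is the characteristic function of $[0,\infty)$ and $\sigma_-$ that of $(-\infty,0)$. Set $m_f^\emptyset=1$ and, for $\varepsilon=(\varepsilon_1,\dots,\varepsilon_n)$, $n\ge 1$, $$m_f^{\varepsilon}=\int_{\mathbb{R}^n}f(x_1)\cdots f(x_n)\,\sigma_{\varepsilon_1}(x_1)\sigma_{\varepsilon_2}(x_1+x_2)\cdots\sigma_{\varepsilon_n}(x_1+\dots+x_n)\,dx_1\cdots dx_n .$$ For $n\ge2$, $$d_f^{\varepsilon}=\varepsilon_n\int_{\mathbb{R}^n}f(x_1)\cdots f(x_n)\,\sigma_{\varepsilon_1}(x_1)\cdots\sigma_{\varepsilon_{n-1}}(x_1+\dots+x_{n-1})\,\delta(x_1+\dots+x_n)\,dx_1\cdots dx_n,$$ where $\delta$ is the Dirac distribution at $0$, i.e. $d_f^\varepsilon=\varepsilon_n\int_{\mathbb{R}^{n-1}}f(x_1)\cdots f(x_{n-1})f(-x_1-\dots-x_{n-1})\sigma_{\varepsilon_1}(x_1)\cdots\sigma_{\varepsilon_{n-1}}(x_1+\dots+x_{n-1})\,dx_1\cdots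 dx_{n-1}$. For $n=1$, $d_f^{+}=-d_f^{-}=f(0)$ if $f$ is continuous at $0$, and otherwise $d_f^+=-d_f^-$ is an arbitrary fixed real number. *)

theory Defs
  imports "HOL-Analysis.Analysis" "HOL-Analysis.Finite_Function_Topology"
begin

section \<open>Compositions\<close>

typedef composition = "{xs :: nat list. 0 \<notin> set xs}"
  morphisms parts Composition
  by (rule exI[of _ "[]"]) simp

setup_lifting type_definition_composition

text \<open>Concatenation makes the compositions into the free monoid on the letters \<open>1, 2, \<dots>\<close>.
  The library writes this (noncommutative) monoid additively, as the exponent monoid of
  \<^typ>\<open>composition \<Rightarrow>\<^sub>0 real\<close>.\<close>

instantiation composition :: monoid_add
begin

lift_definition zero_composition :: composition is "[]" by simp

lift_definition plus_composition :: "composition \<Rightarrow> composition \<Rightarrow> composition" is "(@)" by simp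

instance by standard (transfer; simp)+

end

lift_definition weight :: "composition \<Rightarrow> nat" is sum_list .

lift_definition Des :: "composition \<Rightarrow> nat set"
  is "\<lambda>xs. {sum_list (take k xs) | k. 0 < k \<and> k < length xs}" .

lift_definition len :: "composition \<Rightarrow> nat" is length .

text \<open>\<open>coarser J I\<close> is \<open>J \<le> I\<close>.\<close>

definition coarser :: "composition \<Rightarrow> composition \<Rightarrow> bool" where
  "coarser J I \<longleftrightarrow> weight J = weight I \<and> Des J \<subseteq> Des I"

lemma finite_Des: "finite (Des I)"
  by transfer simp

lemma finite_weight: "finite {I. weight I = n}"
proof -
  have len: "length xs \<le> sum_list xs" if "0 \<notin> set xs" for xs :: "nat list"
    using that by (induction xs) auto
  have "set (parts I) \<subseteq> {..weight I} \<and> length (parts I) \<le> weight I" for I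
    using len[of "parts I"] parts[of I]
    by (simp add: weight.rep_eq subset_iff member_le_sum_list)
  then have "parts ` {I. weight I = n} \<subseteq> {xs. set xs \<subseteq> {..n} \<and> length xs \<le> n}"
    by auto
  moreover have "finite {xs. set xs \<subseteq> {..n} \<and> length xs \<le> n}"
    by (rule finite_lists_length_le) simp
  moreover have "inj_on parts {I. weight I = n}"
    by (simp add: inj_on_def parts_inject)
  ultimately show ?thesis
    by (intro finite_imageD[of parts]) (rule finite_subset)
qed

text \<open>\<open>Des\<close> is a bijection from the compositions of \<open>n\<close> onto the subsets of \<open>{1, \<dots>, n - 1}\<close>.\<close>

lemma Des_list_Cons:
  fixes x :: nat
  shows "{sum_list (take k (x # xs)) | k. 0 < k \<and> k < length (x # xs)} =
    (if xs = [] then {}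
     else insert x ((+) x ` {sum_list (take k xs) | k. 0 < k \<and> k < length xs}))"
proof (cases "xs = []")
  case False
  have img: "{sum_list (take k zs) | k. 0 < k \<and> k < length zs} =
      (\<lambda>k. sum_list (take k zs)) ` {0<..<length zs}" for zs :: "nat list"
    by auto
  have "k \<in> {0<..<length (x # xs)} \<longleftrightarrow> k \<in> Suc ` insert 0 {0<..<length xs}" for k
    using False by (cases k) auto
  then have "{0<..<length (x # xs)} = Suc ` insert 0 {0<..<length xs}"
    by blast
  then show ?thesis
    using False unfolding img by (simp add: image_image)
qed auto

lemma Des_list_pos:
  fixes xs :: "nat list"
  assumes "0 \<notin> set xs" "d \<in> {sum_list (take k xs) | k. 0 < k \<and> k < length xs}"
  shows "0 < d"
  using assms by (cases xs) (auto simp: take_Cons')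

lemma Des_list_inj:
  fixes xs ys :: "nat list"
  assumes "0 \<notin> set xs" "0 \<notin> set ys" "sum_list xs = sum_list ys"
    "{sum_list (take k xs) | k. 0 < k \<and> k < length xs} =
     {sum_list (take k ys) | k. 0 < k \<and> k < length ys}"
  shows "xs = ys"
  using assms
proof (induction xs arbitrary: ys)
  case Nil
  then show ?case by (cases ys) auto
next
  case (Cons x xs)
  then obtain y ys' where ys: "ys = y # ys'"
    by (cases ys) auto
  define D where "D = (\<lambda>zs :: nat list. {sum_list (take k zs) | k. 0 < k \<and> k < length zs})"
  have D_Cons: "D (z # zs) = (if zs = [] then {} else insert z ((+) z ` D zs))" for z zs
    unfolding D_def by (rule Des_list_Cons)
  have pos: "0 < d" if "d \<in> D zs" "0 \<notin> set zs" for d zs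
    using that Des_list_pos unfolding D_def by blast
  have eq: "D (x # xs) = D (y # ys')"
    using Cons.prems(4) unfolding ys D_def .
  show ?case
  proof (cases "xs = []")
    case True
    then have "ys' = []" using eq by (auto simp: D_Cons split: if_splits)
    then show ?thesis using Cons.prems True ys by simp
  next
    case False
    then have ne: "ys' \<noteq> []" using eq by (auto simp: D_Cons split: if_splits)
    have eq': "insert x ((+) x ` D xs) = insert y ((+) y ` D ys')"
      using eq False ne by (simp add: D_Cons)
    have p1: "\<forall>d \<in> D xs. 0 < d" and p2: "\<forall>d \<in> D ys'. 0 < d"
      using pos Cons.prems ys by auto
    have "y \<le> x" using eq' by auto
    moreover have "x \<le> y" using eq' by auto
    ultimately have xy: "x = y" by simp
    have "x \<notin> (+) x ` D xs" "x \<notin> (+) x ` D ys'"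
      using p1 p2 by fastforce+
    then have "(+) x ` D xs = (+) x ` D ys'"
      using eq' unfolding xy by (simp add: insert_ident)
    then have "D xs = D ys'"
      by (simp add: inj_image_eq_iff)
    then have "xs = ys'"
      using Cons.IH[of ys'] Cons.prems ys xy unfolding D_def by simp
    then show ?thesis using ys xy by simp
  qed
qed

lemma Des_inj:
  assumes "weight I = weight J" "Des I = Des J"
  shows "I = J"
  using assms by transfer (rule Des_list_inj)

lemma Des_exists:
  assumes "A \<subseteq> {0<..<n}"
  shows "\<exists>I. weight I = n \<and> Des I = A"
proof -
  have "\<exists>xs \<in> {xs. 0 \<notin> set xs}. sum_list xs = n \<and>
    {sum_list (take k xs) | k. 0 < k \<and> k < length xs} = A"
    using assms
  proof (induction n arbitrary: A rule: less_induct)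
    case (less n)
    show ?case
    proof (cases "A = {}")
      case True
      show ?thesis
      proof (cases "n = 0")
        case True
        then show ?thesis using \<open>A = {}\<close> by (intro bexI[of _ "[]"]) auto
      next
        case False
        then show ?thesis using \<open>A = {}\<close> by (intro bexI[of _ "[n]"]) auto
      qed
    next
      case False
      have fin: "finite A" using less.prems finite_subset by blast
      define a where "a = Max A"
      have a: "a \<in> A" "\<And>b. b \<in> A \<Longrightarrow> b \<le> a"
        using False fin by (auto simp: a_def)
      have an: "0 < a" "a < n" using a(1) less.prems by auto
      have "A - {a} \<subseteq> {0<..<a}"
        using a less.prems by fastforce
      then obtain xs where xs: "0 \<notin> set xs" "sum_list xs = a"
        "{sum_list (take k xs) | k. 0 < k \<and> k < length xs} = A - {a}"
        using less.IH[OF an(2), of "A - {a}"] by auto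
      have ne: "xs \<noteq> []" using xs an by auto
      have "{sum_list (take k (xs @ [n - a])) | k. 0 < k \<and> k < length (xs @ [n - a])} =
        insert (sum_list xs) {sum_list (take k xs) | k. 0 < k \<and> k < length xs}" (is "?L = ?R")
      proof
        show "?L \<subseteq> ?R" by (auto simp: less_Suc_eq)
        have "sum_list xs \<in> ?L"
          using ne by (intro CollectI exI[of _ "length xs"]) auto
        moreover have "sum_list (take k xs) \<in> ?L" if "0 < k" "k < length xs" for k
          using that by (intro CollectI exI[of _ k]) auto
        ultimately show "?R \<subseteq> ?L" by blast
      qed
      also have "\<dots> = A" using xs a by auto
      finally show ?thesis
        using xs an by (intro bexI[of _ "xs @ [n - a]"]) auto
    qed
  qed
  then show ?thesis by transfer
qed


section \<open>Noncommutative symmetric functions\<close>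

text \<open>The free algebra on \<open>S\<^sub>1, S\<^sub>2, \<dots>\<close> is the monoid algebra of the compositions, the basis
  element at \<open>I\<close> being \<open>S\<^sup>I\<close>; its tensor square is the monoid algebra of pairs of
  compositions, the basis element at \<open>(I, J)\<close> being \<open>S\<^sup>I \<otimes> S\<^sup>J\<close>.\<close>

type_synonym sym = "composition \<Rightarrow>\<^sub>0 real"
type_synonym sym2 = "composition \<times> composition \<Rightarrow>\<^sub>0 real"

definition S_word :: "composition \<Rightarrow> sym" where
  "S_word I = Poly_Mapping.single I 1"

definition S_gen :: "nat \<Rightarrow> sym" where
  "S_gen n = (if n = 0 then 1 else S_word (Composition [n]))"

definition tensor :: "sym \<Rightarrow> sym \<Rightarrow> sym2" where
  "tensor p q = (\<Sum>I \<in> Poly_Mapping.keys p. \<Sum>J \<in> Poly_Mapping.keys q.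
     Poly_Mapping.single (I, J) (Poly_Mapping.lookup p I * Poly_Mapping.lookup q J))"

text \<open>The value of the coproduct on the basis is forced by multiplicativity; the lemmas
  \<open>coproduct_S_gen\<close>, \<open>coproduct_one\<close> and \<open>coproduct_mult\<close> below recover its definition as an
  algebra morphism.\<close>

definition coproduct_word :: "composition \<Rightarrow> sym2" where
  "coproduct_word I =
     prod_list (map (\<lambda>n. \<Sum>k\<le>n. tensor (S_gen k) (S_gen (n - k))) (parts I))"

definition coproduct :: "sym \<Rightarrow> sym2" where
  "coproduct p = (\<Sum>I \<in> Poly_Mapping.keys p. Poly_Mapping.lookup p I *\<^sub>R coproduct_word I)"

lemma lookup_scaleR_pm [simp]:
  fixes p :: "'a \<Rightarrow>\<^sub>0 real"
  shows "Poly_Mapping.lookup (c *\<^sub>R p) i = c * Poly_Mapping.lookup p i"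
proof -
  have "finite {i. c * Poly_Mapping.lookup p i \<noteq> 0}"
    by (rule finite_subset[OF _ finite_lookup[of p]]) auto
  then show ?thesis by (simp add: scaleR_poly_mapping_def)
qed

lemma scaleR_single [simp]:
  "c *\<^sub>R Poly_Mapping.single I (a :: real) = Poly_Mapping.single I (c * a)"
  by (rule poly_mapping_eqI) (simp add: lookup_single when_def)

lemma sum_single_keys:
  fixes p :: "'a \<Rightarrow>\<^sub>0 real"
  shows "(\<Sum>I \<in> Poly_Mapping.keys p. Poly_Mapping.single I (Poly_Mapping.lookup p I)) = p"
  by (rule poly_mapping_eqI)
    (simp add: lookup_sum lookup_single when_def in_keys_iff sum.delta')

lemma single_induct [case_names zero single add]:
  fixes p :: "'a \<Rightarrow>\<^sub>0 real"
  assumes "P 0" "\<And>I a. P (Poly_Mapping.single I a)" "\<And>p q. P p \<Longrightarrow> P q \<Longrightarrow> P (p + q)"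
  shows "P p"
proof -
  have "P (\<Sum>I \<in> A. Poly_Mapping.single I (Poly_Mapping.lookup p I))" if "finite A" for A
    using that by (induction A) (auto intro: assms)
  from this[OF finite_keys[of p]] show ?thesis by (simp add: sum_single_keys)
qed

lemma scaleR_mult_pm:
  fixes p q :: "'a::monoid_add \<Rightarrow>\<^sub>0 real"
  shows "(c *\<^sub>R p) * (d *\<^sub>R q) = (c * d) *\<^sub>R (p * q)"
proof (induction p rule: single_induct)
  case (single I a)
  show ?case
    by (induction q rule: single_induct)
      (simp_all add: mult_single scaleR_add_right distrib_left mult_ac)
qed (simp_all add: scaleR_add_right distrib_right)

lemma coproduct_superset:
  assumes "finite A" "Poly_Mapping.keys p \<subseteq> A"
  shows "coproduct p = (\<Sum>I \<in> A. Poly_Mapping.lookup p I *\<^sub>R coproduct_word I)"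
  unfolding coproduct_def using assms
  by (intro sum.mono_neutral_left) (auto simp: in_keys_iff)

lemma coproduct_single:
  "coproduct (Poly_Mapping.single I a) = a *\<^sub>R coproduct_word I"
  by (subst coproduct_superset[of "{I}"]) auto

lemma coproduct_word_plus: "coproduct_word (I + J) = coproduct_word I * coproduct_word J"
  by (simp add: coproduct_word_def plus_composition.rep_eq)

lemma coproduct_add: "coproduct (p + q) = coproduct p + coproduct q"
  using keys_add[of p q]
  by (simp add: coproduct_superset[of "Poly_Mapping.keys p \<union> Poly_Mapping.keys q"]
      lookup_add scaleR_add_left sum.distrib)

lemma coproduct_scaleR: "coproduct (c *\<^sub>R p) = c *\<^sub>R coproduct p"
  by (induction p rule: single_induct)
    (simp_all add: coproduct_single coproduct_add scaleR_add_right, simp add: coproduct_def)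

lemma coproduct_one: "coproduct 1 = 1"
  using coproduct_single[of 0 1]
  by (simp add: coproduct_word_def zero_composition.rep_eq)

lemma coproduct_mult: "coproduct (p * q) = coproduct p * coproduct q"
proof (induction p rule: single_induct)
  case zero
  show ?case by (simp add: coproduct_def)
next
  case (single I a)
  show ?case
  proof (induction q rule: single_induct)
    case zero
    show ?case by (simp add: coproduct_def)
  next
    case (single J b)
    show ?case
      by (simp add: mult_single coproduct_single coproduct_word_plus scaleR_mult_pm)
  next
    case (add p q)
    then show ?case by (simp add: distrib_left coproduct_add)
  qed
next
  case (add p q)
  then show ?case by (simp add: distrib_right coproduct_add)
qed

lemma tensor_one: "tensor 1 1 = 1"
proof -
  have "tensor (Poly_Mapping.single 0 1) (Poly_Mapping.single 0 1) = Poly_Mapping.single (0, 0) 1"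
    by (simp add: tensor_def del: single_one)
  then show ?thesis by (simp flip: zero_prod_def)
qed

lemma coproduct_S_gen: "coproduct (S_gen n) = (\<Sum>k\<le>n. tensor (S_gen k) (S_gen (n - k)))"
proof (cases "n = 0")
  case True
  then show ?thesis by (simp add: S_gen_def coproduct_one tensor_one)
next
  case False
  then show ?thesis
    by (simp add: S_gen_def[of n] S_word_def coproduct_single coproduct_word_def
        Composition_inverse)
qed

lemma S_word_eq_prod: "S_word I = prod_list (map S_gen (parts I))"
proof -
  have "S_word (Composition xs) = prod_list (map S_gen xs)" if "0 \<notin> set xs" for xs
    using that
  proof (induction xs)
    case Nil
    then show ?case by (simp add: S_word_def flip: zero_composition_def)
  next
    case (Cons x xs)
    have "Composition (x # xs) = Composition [x] + Composition xs"
      using Cons.prems by (simp add: plus_composition.abs_eq eq_onp_def)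
    then have "S_word (Composition (x # xs)) = S_gen x * S_word (Composition xs)"
      using Cons.prems by (simp add: S_word_def S_gen_def[of x] mult_single)
    with Cons show ?case by simp
  qed
  from this[of "parts I"] parts[of I] show ?thesis by (simp add: parts_inverse)
qed

text \<open>The ribbon basis, obtained by solving \<open>S\<^sup>I = (\<Sum>J\<le>I. R\<^sub>J)\<close> for \<open>R\<^sub>I\<close>.\<close>

function ribbon :: "composition \<Rightarrow> sym" where
  "ribbon I = S_word I - (\<Sum>J \<in> {J. weight J = weight I \<and> Des J \<subset> Des I}. ribbon J)"
  by auto
termination
  by (relation "Wellfounded.measure (\<lambda>I. card (Des I))") (auto intro: psubset_card_mono finite_Des)

declare ribbon.simps [simp del]

lemma finite_coarser: "finite {J. coarser J I}"
  by (rule finite_subset[OF _ finite_weight[of "weight I"]]) (auto simp: coarser_def)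

lemma coarser_split:
  "{J. coarser J I} = insert I {J. weight J = weight I \<and> Des J \<subset> Des I}"
  using Des_inj by (auto simp: coarser_def)

lemma sum_coarser:
  fixes r :: "composition \<Rightarrow> sym"
  shows "(\<Sum>J \<in> {J. coarser J I}. r J) =
    r I + (\<Sum>J \<in> {J. weight J = weight I \<and> Des J \<subset> Des I}. r J)"
  unfolding coarser_split
  using finite_coarser[of I] unfolding coarser_split by (subst sum.insert) auto

lemma S_word_ribbon: "S_word I = (\<Sum>J \<in> {J. coarser J I}. ribbon J)"
  by (simp add: sum_coarser ribbon.simps[of I])

lemma ribbon_unique:
  assumes "\<And>I. S_word I = (\<Sum>J \<in> {J. coarser J I}. r J)"
  shows "r = ribbon"
proof
  fix I
  show "r I = ribbon I"
  proof (induction I rule: ribbon.induct)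
    case (1 I)
    have "r I = S_word I - (\<Sum>J \<in> {J. weight J = weight I \<and> Des J \<subset> Des I}. r J)"
      using assms[of I] by (simp add: sum_coarser)
    also have "\<dots> = ribbon I"
      unfolding ribbon.simps[of I] using 1
      by (intro arg_cong2[where f = "(-)"] sum.cong) auto
    finally show ?case .
  qed
qed


section \<open>Signed ribbons\<close>

datatype sign = Plus | Minus

primrec sgn_val :: "sign \<Rightarrow> real" where
  "sgn_val Plus = 1"
| "sgn_val Minus = -1"

text \<open>The sign \<open>\<epsilon>\<^sub>i\<close> is \<open>\<epsilon> ! (i - 1)\<close>.\<close>

definition signed_composition :: "sign list \<Rightarrow> composition" where
  "signed_composition \<epsilon> = (THE I. weight I = Suc (length \<epsilon>) \<and>
     Des I = {Suc i | i. i < length \<epsilon> \<and> \<epsilon> ! i = Minus})"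

lemma signed_composition:
  "weight (signed_composition \<epsilon>) = Suc (length \<epsilon>)"
  "Des (signed_composition \<epsilon>) = {Suc i | i. i < length \<epsilon> \<and> \<epsilon> ! i = Minus}"
proof -
  let ?P = "\<lambda>I. weight I = Suc (length \<epsilon>) \<and>
    Des I = {Suc i | i. i < length \<epsilon> \<and> \<epsilon> ! i = Minus}"
  have "\<exists>I. ?P I"
    by (rule Des_exists) auto
  then have "\<exists>!I. ?P I"
    using Des_inj by (intro ex_ex1I) auto
  then have "?P (signed_composition \<epsilon>)"
    unfolding signed_composition_def by (rule theI')
  then show "weight (signed_composition \<epsilon>) = Suc (length \<epsilon>)"
    "Des (signed_composition \<epsilon>) = {Suc i | i. i < length \<epsilon> \<and> \<epsilon> ! i = Minus}"
    by auto
qed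

definition signed_ribbon :: "sign list \<Rightarrow> sym" where
  "signed_ribbon \<epsilon> =
     (-1) ^ (len (signed_composition \<epsilon>) - 1) *\<^sub>R ribbon (signed_composition \<epsilon>)"


section \<open>Formal series\<close>

text \<open>An element of the completion is the sequence of its homogeneous components, and likewise
  for the completed tensor square, graded by total degree.\<close>

definition formal_series :: "(nat \<Rightarrow> sym) \<Rightarrow> bool" where
  "formal_series G \<longleftrightarrow> (\<forall>n. \<forall>I \<in> Poly_Mapping.keys (G n). weight I = n)"

definition series_one :: "nat \<Rightarrow> sym" where
  "series_one n = (if n = 0 then 1 else 0)"

definition series_tensor :: "(nat \<Rightarrow> sym) \<Rightarrow> (nat \<Rightarrow> sym) \<Rightarrow> nat \<Rightarrow> sym2" where
  "series_tensor G H n = (\<Sum>k\<le>n. tensor (G k) (H (n - k)))"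

definition series_coproduct :: "(nat \<Rightarrow> sym) \<Rightarrow> nat \<Rightarrow> sym2" where
  "series_coproduct G n = coproduct (G n)"

definition grouplike :: "(nat \<Rightarrow> sym) \<Rightarrow> bool" where
  "grouplike G \<longleftrightarrow> formal_series G \<and> G 0 = 1 \<and> series_coproduct G = series_tensor G G"

definition primitive :: "(nat \<Rightarrow> sym) \<Rightarrow> bool" where
  "primitive D \<longleftrightarrow> formal_series D \<and>
     series_coproduct D = (\<lambda>n. series_tensor D series_one n + series_tensor series_one D n)"

text \<open>\<open>ribbon_series c\<close> is the series \<open>\<Sum>\<epsilon>. c \<epsilon> R\<^sub>\<epsilon>\<^sub>\<bullet>\<close> over all sign sequences; its component
  of degree \<open>n\<close> collects the \<open>\<epsilon>\<close> of length \<open>n - 1\<close>.\<close>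

definition ribbon_series :: "(sign list \<Rightarrow> real) \<Rightarrow> nat \<Rightarrow> sym" where
  "ribbon_series c n =
     (if n = 0 then 0 else \<Sum>\<epsilon> \<in> {\<epsilon>. length \<epsilon> = n - 1}. c \<epsilon> *\<^sub>R signed_ribbon \<epsilon>)"


section \<open>Weights\<close>

fun sigma :: "sign \<Rightarrow> real \<Rightarrow> real" where
  "sigma Plus = indicator {0..}"
| "sigma Minus = indicator {..<0}"

text \<open>Lebesgue measure on \<open>\<real>\<^sup>n\<close>. The completion matters because \<open>f\<close> is only assumed to be
  Lebesgue measurable.\<close>

definition lebesgue_n :: "nat \<Rightarrow> (nat \<Rightarrow> real) measure" where
  "lebesgue_n n = completion (Pi\<^sub>M {..<n} (\<lambda>_. lborel))"

text \<open>For the empty sequence the integral is over a point and equals 1.\<close>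

definition m_weight :: "(real \<Rightarrow> real) \<Rightarrow> sign list \<Rightarrow> real" where
  "m_weight f \<epsilon> = (\<integral>x. (\<Prod>i<length \<epsilon>. f (x i)) *
     (\<Prod>i<length \<epsilon>. sigma (\<epsilon> ! i) (\<Sum>j\<le>i. x j)) \<partial>lebesgue_n (length \<epsilon>))"

lemma m_weight_Nil: "m_weight f [] = 1"
proof -
  have "integral\<^sup>L (completion (Pi\<^sub>M {} (\<lambda>_. lborel))) (\<lambda>_ :: nat \<Rightarrow> real. 1 :: real) =
      integral\<^sup>L (Pi\<^sub>M {} (\<lambda>_ :: nat. lborel :: real measure)) (\<lambda>_. 1)"
    by (subst integral_completion) auto
  then show ?thesis
    by (simp add: m_weight_def lebesgue_n_def PiM_empty lebesgue_integral_count_space_finite)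
qed

text \<open>The number \<open>c\<close> is the weight of the one-letter sequence \<open>+\<close>, left free when \<open>f\<close> is
  discontinuous at 0. The empty sequence carries no weight; it gets the value 0 here.\<close>

definition d_weight :: "real \<Rightarrow> (real \<Rightarrow> real) \<Rightarrow> sign list \<Rightarrow> real" where
  "d_weight c f \<epsilon> =
     (if length \<epsilon> = 0 then 0
      else if length \<epsilon> = 1 then sgn_val (last \<epsilon>) * c
      else sgn_val (last \<epsilon>) *
        (\<integral>x. (\<Prod>i<length \<epsilon> - 1. f (x i)) * f (- (\<Sum>i<length \<epsilon> - 1. x i)) *
           (\<Prod>i<length \<epsilon> - 1. sigma (\<epsilon> ! i) (\<Sum>j\<le>i. x j)) \<partial>lebesgue_n (length \<epsilon> - 1)))"


section \<open>The three series\<close>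

definition R_series :: "(real \<Rightarrow> real) \<Rightarrow> nat \<Rightarrow> sym" where
  "R_series f n = series_one n + ribbon_series (\<lambda>\<epsilon>. m_weight f (\<epsilon> @ [Plus])) n"

definition L_series :: "(real \<Rightarrow> real) \<Rightarrow> nat \<Rightarrow> sym" where
  "L_series f n = series_one n - ribbon_series (\<lambda>\<epsilon>. m_weight f (\<epsilon> @ [Minus])) n"

definition D_series :: "real \<Rightarrow> (real \<Rightarrow> real) \<Rightarrow> nat \<Rightarrow> sym" where
  "D_series c f = ribbon_series (\<lambda>\<epsilon>. d_weight c f (\<epsilon> @ [Plus]))"

end

theory Submission
  imports Defs
begin

text \<open>Read \<open>f\<close> as the signed step density of a walk on the line. Let \<open>U\<close> be the operator
  \<open>(U h)(s) = \<integral> f(x) h(s + x) dx\<close> and let \<open>N\<close> be multiplication by minus the indicator of the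
  negative half-line. The proof rests on three observations.

  The coefficients on the words \<open>S\<^sup>J\<close> are simpler than those on the ribbons. Expanding
  \<open>S\<^sup>J\<close> into ribbons shows that the signed weight of \<open>\<epsilon>\<close> must be the sum of the word coefficients
  over all sign sequences that have a minus wherever \<open>\<epsilon>\<close> has one. Since \<open>1 + N\<close> is multiplication
  by the indicator of \<open>[0, \<infinity>)\<close>, this holds if each minus contributes \<open>N\<close> and each plus nothing:
  the coefficient of \<open>S\<^sup>J\<close> in \<open>L\<^sub>f\<close>, for \<open>J = (j\<^sub>1, \<dots>, j\<^sub>r)\<close>, is
  \<open>(U\<^bsup>j\<^sub>1\<^esup> N \<dots> U\<^bsup>j\<^sub>r\<^esup> N 1)(0)\<close>, which constrains the walk only at the ends of the parts. For
  \<open>R\<^sub>f\<close> the last \<open>N 1\<close> is replaced by the indicator of \<open>[0, \<infinity>)\<close>, for \<open>D\<^sub>f\<close> by the Dirac mass at 0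
  (lemmas \<open>ribbon_series_eq_S_series\<close>, \<open>sum_finer_terminal_weight\<close>, \<open>integral_sign_walk\<close>).

  A series is grouplike when its word coefficients are multiplicative for the quasi-shuffle
  product of compositions, and primitive when they vanish on products of nonempty compositions
  (\<open>grouplike_S_series\<close>, \<open>primitive_S_series\<close>). The last part of a quasi-shuffle of \<open>A\<close> and \<open>B\<close> is
  the last part of \<open>A\<close>, the last part of \<open>B\<close>, or their sum (\<open>dual_product_snoc_snoc\<close>).

  These three cases match the three terms of a Rota-Baxter identity. For two walks at \<open>s\<close> and \<open>t\<close>
  we have \<open>[s < 0][t < 0] = [s + t < 0]([s < 0] + [t < 0] - 1)\<close>, that is,
  \<open>N\<^sub>1 N\<^sub>2 = (N\<^sub>1 + N\<^sub>2 + 1) N\<close> with \<open>N\<close> acting on functions of \<open>s + t\<close>. Peeling off last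
  parts, with Fubini's theorem to move the operators of one walk past those of the other, gives
  multiplicativity for \<open>L\<^sub>f\<close> (\<open>dual_product_word_op\<close>). For a general last factor the same peeling
  reduces the question to \<open>(N\<^sub>1 + N\<^sub>2 + 1) k(s + t)\<close> (\<open>dual_product_terminal_weight\<close>). If \<open>k\<close> is
  the indicator of \<open>[0, \<infinity>)\<close>, this is \<open>[s \<ge> 0][t \<ge> 0]\<close>, so \<open>R\<^sub>f\<close> is grouplike. If \<open>k\<close> is the
  Dirac mass, it is supported on the origin of the plane and its integral against a density is 0,
  so \<open>D\<^sub>f\<close> is primitive.\<close>

section \<open>The coproduct on words\<close>

instance composition :: cancel_semigroup_add
  by standard (transfer; simp)+

text \<open>Right cancellation makes multiplication by a basis element a bijection of the coefficients onto
  those at the elements that end in it.\<close>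

lemma lookup_mult_single_add:
  fixes p :: "'a::{monoid_add, cancel_semigroup_add} \<Rightarrow>\<^sub>0 real"
  shows "Poly_Mapping.lookup (p * Poly_Mapping.single k c) (m + k) = Poly_Mapping.lookup p m * c"
  by (induction p rule: single_induct)
    (simp_all add: mult_single lookup_single lookup_add distrib_right when_def)

lemma lookup_mult_single_eq_0:
  fixes p :: "'a::monoid_add \<Rightarrow>\<^sub>0 real"
  assumes "\<And>m'. m \<noteq> m' + k"
  shows "Poly_Mapping.lookup (p * Poly_Mapping.single k c) m = 0"
  using assms
  by (induction p rule: single_induct)
    (simp_all add: mult_single lookup_single lookup_add distrib_right when_def, metis)

text \<open>The value at 0 is the unit of the monoid, in accordance with \<open>S\<^sub>0 = 1\<close>, so that the end terms of
  \<open>\<Delta> S\<^sub>n\<close> have the same form as the others.\<close>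

definition letter :: "nat \<Rightarrow> composition" where
  "letter n = (if n = 0 then 0 else Composition [n])"

lemma letter_0 [simp]: "letter 0 = 0"
  by (simp add: letter_def)

lemma parts_letter: "0 < n \<Longrightarrow> parts (letter n) = [n]"
  by (simp add: letter_def Composition_inverse)

lemma S_gen_eq_single: "S_gen n = Poly_Mapping.single (letter n) 1"
  by (simp add: S_gen_def letter_def S_word_def)

lemma weight_0 [simp]: "weight 0 = 0"
  by transfer simp

lemma weight_add [simp]: "weight (I + J) = weight I + weight J"
  by transfer simp

lemma weight_letter [simp]: "weight (letter n) = n"
  by (simp add: letter_def weight.rep_eq zero_composition.rep_eq Composition_inverse)

lemma weight_eq_0_iff [simp]: "weight I = 0 \<longleftrightarrow> I = 0"
proof transfer
  show "sum_list xs = 0 \<longleftrightarrow> xs = []" if "0 \<notin> set xs" for xs :: "nat list"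
    using that by (cases xs) auto
qed

lemma add_letter_eq_iff [simp]:
  assumes "0 < m" "0 < n"
  shows "I + letter m = J + letter n \<longleftrightarrow> I = J \<and> m = n"
  using assms by (simp add: plus_composition.rep_eq parts_letter flip: parts_inject)

lemma add_letter_neq_0 [simp]: "0 < n \<Longrightarrow> I + letter n \<noteq> 0" "0 < n \<Longrightarrow> 0 \<noteq> I + letter n"
  by (metis add_is_0 less_not_refl weight_0 weight_add weight_letter)+

text \<open>Compositions are taken apart from the right, because the last part of a composition corresponds
  to the innermost factor of an operator word.\<close>

lemma composition_snoc_cases:
  obtains "I = 0" | J n where "0 < n" "I = J + letter n"
proof (cases "parts I" rule: rev_cases)
  case Nil
  then have "I = 0" by (simp add: zero_composition.rep_eq flip: parts_inject)
  then show ?thesis using that by blast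
next
  case (snoc xs x)
  have "0 \<notin> set xs" "0 < x" using parts[of I] by (auto simp: snoc)
  then have "I = Composition xs + letter x"
    using snoc by (simp add: plus_composition.rep_eq parts_letter Composition_inverse flip: parts_inject)
  then show ?thesis using that \<open>0 < x\<close> by blast
qed

lemma composition_snoc_induct [case_names zero snoc]:
  assumes "P 0" and step: "\<And>I n. P I \<Longrightarrow> 0 < n \<Longrightarrow> P (I + letter n)"
  shows "P I"
proof (induction "weight I" arbitrary: I rule: less_induct)
  case less
  show ?case
  proof (cases I rule: composition_snoc_cases)
    case (2 J n)
    with less[of J] step[of J n] show ?thesis by simp
  qed (simp add: assms(1))
qed

lemma sum_weight_snoc:
  assumes "0 < n"
  shows "(\<Sum>J | weight J = n. F J) = (\<Sum>m\<in>{1..n}. \<Sum>J | weight J = n - m. F (J + letter m))"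
proof -
  have "bij_betw (\<lambda>(m, J). J + letter m) (SIGMA m:{1..n}. {J. weight J = n - m}) {J. weight J = n}"
    unfolding bij_betw_def
  proof (intro conjI set_eqI iffI)
    fix J assume "J \<in> {J. weight J = n}"
    then show "J \<in> (\<lambda>(m, J). J + letter m) ` (SIGMA m:{1..n}. {J. weight J = n - m})"
      using assms by (cases J rule: composition_snoc_cases) (force simp: image_iff)+
  qed (auto simp: inj_on_def)
  then have "(\<Sum>J | weight J = n. F J) =
    (\<Sum>(m, J)\<in>(SIGMA m:{1..n}. {J. weight J = n - m}). F (J + letter m))"
    by (simp add: case_prod_unfold flip: sum.reindex_bij_betw)
  also have "\<dots> = (\<Sum>m\<in>{1..n}. \<Sum>J | weight J = n - m. F (J + letter m))"
    by (rule sum.Sigma[symmetric]) (auto simp: finite_weight)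
  finally show ?thesis .
qed

lemma tensor_single:
  "tensor (Poly_Mapping.single I a) (Poly_Mapping.single J b) = Poly_Mapping.single (I, J) (a * b)"
  by (simp add: tensor_def)

lemma lookup_tensor:
  "Poly_Mapping.lookup (tensor p q) (A, B) = Poly_Mapping.lookup p A * Poly_Mapping.lookup q B"
proof -
  have "Poly_Mapping.lookup (tensor p q) (A, B) =
    (\<Sum>I\<in>Poly_Mapping.keys p. \<Sum>J\<in>Poly_Mapping.keys q.
      (if I = A then if J = B then Poly_Mapping.lookup p A * Poly_Mapping.lookup q B else 0 else 0))"
    unfolding tensor_def lookup_sum
    by (intro sum.cong refl) (auto simp: lookup_single when_def)
  also have "\<dots> = (\<Sum>I\<in>Poly_Mapping.keys p. if I = A then 
      \<Sum>J\<in>Poly_Mapping.keys q. if J = B then Poly_Mapping.lookup p A * Poly_Mapping.lookup q B else 0 else 0)"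
    by (intro sum.cong) auto
  also have "\<dots> = Poly_Mapping.lookup p A * Poly_Mapping.lookup q B"
    by (simp add: in_keys_iff)
  finally show ?thesis .
qed

abbreviation coproduct_coeff :: "composition \<Rightarrow> composition \<Rightarrow> composition \<Rightarrow> real" where
  "coproduct_coeff J A B \<equiv> Poly_Mapping.lookup (coproduct_word J) (A, B)"

lemma coproduct_word_letter:
  assumes "0 < m"
  shows "coproduct_word (letter m) = (\<Sum>k\<le>m. Poly_Mapping.single (letter k, letter (m - k)) 1)"
  by (simp add: coproduct_word_def parts_letter assms S_gen_eq_single tensor_single)

lemma coproduct_coeff_zero: "coproduct_coeff 0 A B = (if A = 0 \<and> B = 0 then 1 else 0)"
proof -
  have "coproduct_word 0 = Poly_Mapping.single (0, 0) 1"
    by (simp add: coproduct_word_def zero_composition.rep_eq flip: zero_prod_def)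
  then show ?thesis by (auto simp: lookup_single when_def)
qed

lemma coproduct_coeff_add_letter:
  assumes "0 < m"
  shows "coproduct_coeff (J + letter m) A B = 
    (\<Sum>k\<le>m. Poly_Mapping.lookup (coproduct_word J * Poly_Mapping.single (letter k, letter (m - k)) 1) (A, B))"
  by (simp add: coproduct_word_plus coproduct_word_letter assms sum_distrib_left lookup_sum)

lemma lookup_strip:
  fixes p :: sym2
  shows "Poly_Mapping.lookup (p * Poly_Mapping.single (x, y) 1) (A + x, B + y) = Poly_Mapping.lookup p (A, B)"
  using lookup_mult_single_add[of p "(x, y)" 1 "(A, B)"] by simp

lemma sum_first_last_inner:
  fixes F :: "nat \<Rightarrow> real"
  assumes "0 < m"
  shows "(\<Sum>k\<le>m. F k) = F 0 + F m + (\<Sum>k\<in>{0<..<m}. F k)"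
proof -
  have "{..m} = insert 0 (insert m {0<..<m})" using assms by auto
  then show ?thesis using assms by simp
qed

text \<open>The last factor \<open>\<Delta> S\<^sub>m\<close> can put its whole weight on the left, its whole weight on the right, or
  split it; in each case it must supply the last letter of every side on which it puts weight.\<close>

lemma coproduct_coeff_snoc_snoc:
  assumes "0 < m" "0 < a" "0 < b"
  shows "coproduct_coeff (J + letter m) (A + letter a) (B + letter b) =
    (if m = a then coproduct_coeff J A (B + letter b) else 0) +
    (if m = b then coproduct_coeff J (A + letter a) B else 0) +
    (if m = a + b then coproduct_coeff J A B else 0)"
proof -
  define F where "F k = Poly_Mapping.lookup
    (coproduct_word J * Poly_Mapping.single (letter k, letter (m - k)) 1) (A + letter a, B + letter b)" for k
  have F0: "F 0 = (if m = b then coproduct_coeff J (A + letter a) B else 0)"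
    using lookup_strip[of "coproduct_word J" 0 "letter b" "A + letter a" B] assms
    by (auto simp: F_def intro!: lookup_mult_single_eq_0)
  have Fm: "F m = (if m = a then coproduct_coeff J A (B + letter b) else 0)"
    using lookup_strip[of "coproduct_word J" "letter a" 0 A "B + letter b"] assms
    by (auto simp: F_def intro!: lookup_mult_single_eq_0)
  have Fk: "F k = (if k = a then (if m = a + b then coproduct_coeff J A B else 0) else 0)"
    if "k \<in> {0<..<m}" for k
    using lookup_strip[of "coproduct_word J" "letter a" "letter b" A B] assms that
    by (auto simp: F_def intro!: lookup_mult_single_eq_0)
  have "(\<Sum>k\<in>{0<..<m}. F k) = (if m = a + b then coproduct_coeff J A B else 0)"
  proof -
    have "(\<Sum>k\<in>{0<..<m}. F k) =
        (\<Sum>k\<in>{0<..<m}. if k = a then (if m = a + b then coproduct_coeff J A B else 0) else 0)"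
      by (intro sum.cong refl Fk)
    then show ?thesis using assms by auto
  qed
  then show ?thesis
    unfolding coproduct_coeff_add_letter[OF assms(1)] F_def[symmetric] sum_first_last_inner[OF assms(1)]
    by (simp add: F0 Fm)
qed

lemma coproduct_coeff_snoc_0:
  assumes "0 < m" "0 < a"
  shows "coproduct_coeff (J + letter m) (A + letter a) 0 = (if m = a then coproduct_coeff J A 0 else 0)"
proof -
  define F where "F k = Poly_Mapping.lookup
    (coproduct_word J * Poly_Mapping.single (letter k, letter (m - k)) 1) (A + letter a, 0)" for k
  have "F m = (if m = a then coproduct_coeff J A 0 else 0)"
    using lookup_strip[of "coproduct_word J" "letter a" 0 A 0] assms
    by (auto simp: F_def intro!: lookup_mult_single_eq_0)
  moreover have "F k = 0" if "k < m" for k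
    using that by (auto simp: F_def intro!: lookup_mult_single_eq_0)
  ultimately show ?thesis
    unfolding coproduct_coeff_add_letter[OF assms(1)] F_def[symmetric] sum_first_last_inner[OF assms(1)]
    by (simp add: assms)
qed

lemma coproduct_coeff_0_snoc:
  assumes "0 < m" "0 < b"
  shows "coproduct_coeff (J + letter m) 0 (B + letter b) = (if m = b then coproduct_coeff J 0 B else 0)"
proof -
  define F where "F k = Poly_Mapping.lookup
    (coproduct_word J * Poly_Mapping.single (letter k, letter (m - k)) 1) (0, B + letter b)" for k
  have "F 0 = (if m = b then coproduct_coeff J 0 B else 0)"
    using lookup_strip[of "coproduct_word J" 0 "letter b" 0 B] assms
    by (auto simp: F_def intro!: lookup_mult_single_eq_0)
  moreover have "F k = 0" if "0 < k" for k
    using that by (auto simp: F_def intro!: lookup_mult_single_eq_0)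
  ultimately show ?thesis
    unfolding coproduct_coeff_add_letter[OF assms(1)] F_def[symmetric] sum_first_last_inner[OF assms(1)]
    by (simp add: assms)
qed

lemma coproduct_coeff_0_0:
  assumes "0 < m"
  shows "coproduct_coeff (J + letter m) 0 0 = 0"
proof -
  have "Poly_Mapping.lookup
    (coproduct_word J * Poly_Mapping.single (letter k, letter (m - k)) 1) (0, 0) = 0" if "k \<le> m" for k
    using that assms by (cases "k = 0") (auto intro!: lookup_mult_single_eq_0)
  then show ?thesis unfolding coproduct_coeff_add_letter[OF assms(1)] by simp
qed

lemma coproduct_coeff_weight:
  assumes "coproduct_coeff J A B \<noteq> 0"
  shows "weight J = weight A + weight B"
  using assms
proof (induction J arbitrary: A B rule: composition_snoc_induct)
  case zero
  then show ?case by (auto simp: coproduct_coeff_zero split: if_splits)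
next
  case (snoc J m)
  show ?case
  proof (cases A rule: composition_snoc_cases; cases B rule: composition_snoc_cases)
    fix A' a B' b
    assume AB: "0 < a" "A = A' + letter a" "0 < b" "B = B' + letter b"
    then show ?thesis
      using snoc.prems snoc.hyps snoc.IH[of A' "B' + letter b"] snoc.IH[of "A' + letter a" B']
        snoc.IH[of A' B']
      by (cases "coproduct_coeff J A' (B' + letter b) = 0"; cases "coproduct_coeff J (A' + letter a) B' = 0")
        (auto simp: coproduct_coeff_snoc_snoc split: if_splits)
  qed (use snoc in \<open>auto simp: coproduct_coeff_0_0 coproduct_coeff_snoc_0 coproduct_coeff_0_snoc
        split: if_splits dest: snoc.IH\<close>)
qed

text \<open>If \<open>M\<^sub>A\<close> denotes the basis dual to the words, this is the value of the linear form
  \<open>M\<^sub>J \<mapsto> w J\<close> at the product \<open>M\<^sub>A M\<^sub>B\<close> in the graded dual. That dual is the algebra of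
  quasisymmetric functions, and the recursion below is the quasi-shuffle rule.\<close>

definition dual_product :: "(composition \<Rightarrow> real) \<Rightarrow> composition \<Rightarrow> composition \<Rightarrow> real" where
  "dual_product w A B = (\<Sum>J | weight J = weight A + weight B. coproduct_coeff J A B * w J)"

lemma dual_product_0_0: "dual_product w 0 0 = w 0"
proof -
  have "{J. weight J = weight 0 + weight 0} = {0}" by auto
  then show ?thesis by (simp add: dual_product_def coproduct_coeff_zero)
qed

lemma sum_coproduct_coeff_other_weight:
  assumes "n \<noteq> weight A + weight B"
  shows "(\<Sum>J | weight J = n. coproduct_coeff J A B * w J) = 0"
  using assms coproduct_coeff_weight by (intro sum.neutral) fastforce

text \<open>The three terms are the three possible last parts of a quasi-shuffle: that of the left factor,
  that of the right factor, and the sum of both.\<close>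

lemma dual_product_snoc_snoc:
  assumes "0 < a" "0 < b"
  shows "dual_product w (A + letter a) (B + letter b) =
    dual_product (\<lambda>J. w (J + letter a)) A (B + letter b) +
    dual_product (\<lambda>J. w (J + letter b)) (A + letter a) B +
    dual_product (\<lambda>J. w (J + letter (a + b))) A B"
proof -
  define n where "n = weight A + a + (weight B + b)"
  have n: "0 < n" using assms by (simp add: n_def)
  have "dual_product w (A + letter a) (B + letter b) =
    (\<Sum>m\<in>{1..n}. \<Sum>J | weight J = n - m. coproduct_coeff (J + letter m) (A + letter a) (B + letter b) * w (J + letter m))"
    unfolding dual_product_def by (simp add: sum_weight_snoc[OF n] flip: n_def)
  also have "\<dots> = (\<Sum>m\<in>{1..n}.
      (if m = a then \<Sum>J | weight J = n - a. coproduct_coeff J A (B + letter b) * w (J + letter a) else 0) +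
      (if m = b then \<Sum>J | weight J = n - b. coproduct_coeff J (A + letter a) B * w (J + letter b) else 0) +
      (if m = a + b then \<Sum>J | weight J = n - (a + b). coproduct_coeff J A B * w (J + letter (a + b)) else 0))"
    using assms by (intro sum.cong refl)
      (auto simp: coproduct_coeff_snoc_snoc distrib_right sum.distrib)
  also have "\<dots> = 
      (\<Sum>J | weight J = n - a. coproduct_coeff J A (B + letter b) * w (J + letter a)) +
      (\<Sum>J | weight J = n - b. coproduct_coeff J (A + letter a) B * w (J + letter b)) +
      (\<Sum>J | weight J = n - (a + b). coproduct_coeff J A B * w (J + letter (a + b)))"
    using assms by (simp add: sum.distrib n_def)
  finally show ?thesis
    by (simp add: dual_product_def n_def algebra_simps)
qed

lemma dual_product_snoc_0:
  assumes "0 < a"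
  shows "dual_product w (A + letter a) 0 = dual_product (\<lambda>J. w (J + letter a)) A 0"
proof -
  have "dual_product w (A + letter a) 0 =
    (\<Sum>m\<in>{1..weight A + a}. \<Sum>J | weight J = weight A + a - m.
      coproduct_coeff (J + letter m) (A + letter a) 0 * w (J + letter m))"
    unfolding dual_product_def using assms by (simp add: sum_weight_snoc)
  also have "\<dots> = (\<Sum>m\<in>{1..weight A + a}. if m = a then
      \<Sum>J | weight J = weight A. coproduct_coeff J A 0 * w (J + letter a) else 0)"
    using assms by (intro sum.cong refl) (auto simp: coproduct_coeff_snoc_0)
  finally show ?thesis using assms by (simp add: dual_product_def)
qed

lemma dual_product_0_snoc:
  assumes "0 < b"
  shows "dual_product w 0 (B + letter b) = dual_product (\<lambda>J. w (J + letter b)) 0 B"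
proof -
  have "dual_product w 0 (B + letter b) =
    (\<Sum>m\<in>{1..weight B + b}. \<Sum>J | weight J = weight B + b - m.
      coproduct_coeff (J + letter m) 0 (B + letter b) * w (J + letter m))"
    unfolding dual_product_def using assms by (simp add: sum_weight_snoc)
  also have "\<dots> = (\<Sum>m\<in>{1..weight B + b}. if m = b then
      \<Sum>J | weight J = weight B. coproduct_coeff J 0 B * w (J + letter b) else 0)"
    using assms by (intro sum.cong refl) (auto simp: coproduct_coeff_0_snoc)
  finally show ?thesis using assms by (simp add: dual_product_def)
qed

lemma dual_product_right_0: "dual_product w A 0 = w A"
  by (induction A arbitrary: w rule: composition_snoc_induct)
    (simp_all add: dual_product_0_0 dual_product_snoc_0)

lemma dual_product_left_0: "dual_product w 0 B = w B"
  by (induction B arbitrary: w rule: composition_snoc_induct)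
    (simp_all add: dual_product_0_0 dual_product_0_snoc)

section \<open>Series with given coefficients on words\<close>

definition S_series :: "(composition \<Rightarrow> real) \<Rightarrow> nat \<Rightarrow> sym" where
  "S_series w n = (\<Sum>J | weight J = n. w J *\<^sub>R S_word J)"

lemma lookup_S_series:
  "Poly_Mapping.lookup (S_series w n) A = (if weight A = n then w A else 0)"
  using finite_weight[of n]
  by (auto simp: S_series_def lookup_sum S_word_def lookup_single when_def sum.If_cases)

lemma formal_series_S_series: "formal_series (S_series w)"
  by (auto simp: formal_series_def in_keys_iff lookup_S_series split: if_splits)

lemma coproduct_0 [simp]: "coproduct 0 = 0"
  by (simp add: coproduct_def)

lemma coproduct_sum: "coproduct (sum F X) = (\<Sum>x\<in>X. coproduct (F x))"
  by (induction X rule: infinite_finite_induct) (simp_all add: coproduct_add)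

lemma lookup_series_coproduct_S_series:
  "Poly_Mapping.lookup (series_coproduct (S_series w) n) (A, B) =
    (if weight A + weight B = n then dual_product w A B else 0)"
proof -
  have "Poly_Mapping.lookup (series_coproduct (S_series w) n) (A, B) =
    (\<Sum>J | weight J = n. coproduct_coeff J A B * w J)"
    by (simp add: series_coproduct_def S_series_def coproduct_sum coproduct_scaleR S_word_def
        coproduct_single lookup_sum mult.commute)
  then show ?thesis
    using sum_coproduct_coeff_other_weight by (auto simp: dual_product_def)
qed

lemma lookup_series_tensor_S_series:
  "Poly_Mapping.lookup (series_tensor (S_series v) (S_series w) n) (A, B) =
    (if weight A + weight B = n then v A * w B else 0)"
proof -
  have "Poly_Mapping.lookup (series_tensor (S_series v) (S_series w) n) (A, B) =
    (\<Sum>k\<le>n. if k = weight A then (if weight A + weight B = n then v A * w B else 0) else 0)"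
    unfolding series_tensor_def lookup_sum lookup_tensor lookup_S_series
    by (intro sum.cong) auto
  then show ?thesis by simp
qed

text \<open>Pairing with the coproduct is the product of the dual, so grouplike series are its characters.\<close>

lemma grouplike_S_series:
  assumes "w 0 = 1" "\<And>A B. dual_product w A B = w A * w B"
  shows "grouplike (S_series w)"
proof -
  have "{J. weight J = 0} = {0}" by auto
  then have "S_series w 0 = 1" by (simp add: S_series_def assms S_word_def)
  moreover have "series_coproduct (S_series w) = series_tensor (S_series w) (S_series w)"
  proof (intro ext poly_mapping_eqI)
    fix n p
    show "Poly_Mapping.lookup (series_coproduct (S_series w) n) p =
      Poly_Mapping.lookup (series_tensor (S_series w) (S_series w) n) p"
      by (cases p) (simp add: lookup_series_coproduct_S_series lookup_series_tensor_S_series assms)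
  qed
  ultimately show ?thesis by (simp add: grouplike_def formal_series_S_series)
qed

lemma series_one_eq_S_series: "series_one = S_series (\<lambda>J. if J = 0 then 1 else 0)"
proof (intro ext poly_mapping_eqI)
  fix n A
  show "Poly_Mapping.lookup (series_one n) A = Poly_Mapping.lookup (S_series (\<lambda>J. if J = 0 then 1 else 0) n) A"
    by (auto simp: series_one_def lookup_S_series lookup_one when_def)
qed

text \<open>The hypotheses say that \<open>w\<close> is an infinitesimal character of the dual: it vanishes on the unit
  and on products of elements without constant term. The components of the coproduct that survive
  have an empty composition on one side.\<close>

lemma primitive_S_series:
  assumes "w 0 = 0" "\<And>A B. A \<noteq> 0 \<Longrightarrow> B \<noteq> 0 \<Longrightarrow> dual_product w A B = 0"
  shows "primitive (S_series w)"
proof -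
  have "dual_product w A B = w A * (if B = 0 then 1 else 0) + (if A = 0 then 1 else 0) * w B" for A B
    using assms by (auto simp: dual_product_left_0 dual_product_right_0)
  then have "series_coproduct (S_series w) =
    (\<lambda>n. series_tensor (S_series w) series_one n + series_tensor series_one (S_series w) n)"
    unfolding series_one_eq_S_series
  proof (intro ext poly_mapping_eqI)
    fix n p
    assume *: "\<And>A B. dual_product w A B = w A * (if B = 0 then 1 else 0) + (if A = 0 then 1 else 0) * w B"
    show "Poly_Mapping.lookup (series_coproduct (S_series w) n) p =
      Poly_Mapping.lookup (series_tensor (S_series w) (S_series (\<lambda>J. if J = 0 then 1 else 0)) n +
        series_tensor (S_series (\<lambda>J. if J = 0 then 1 else 0)) (S_series w) n) p"
      by (cases p) (simp add: lookup_series_coproduct_S_series lookup_series_tensor_S_series lookup_add *)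
  qed
  then show ?thesis by (simp add: primitive_def formal_series_S_series)
qed

section \<open>From signed ribbons to words\<close>

lemma len_0 [simp]: "len 0 = 0"
  by transfer simp

lemma len_add_letter [simp]: "0 < n \<Longrightarrow> len (I + letter n) = Suc (len I)"
  by (simp add: len.rep_eq plus_composition.rep_eq parts_letter)

lemma Des_add_letter:
  assumes "0 < n"
  shows "Des (I + letter n) = (if I = 0 then {} else insert (weight I) (Des I))"
proof (cases "I = 0")
  case True
  then show ?thesis using assms by (auto simp: Des.rep_eq parts_letter)
next
  case False
  define xs where "xs = parts I"
  have "0 < length xs"
    using False by (simp add: xs_def zero_composition.rep_eq flip: parts_inject)
  then have "{k. 0 < k \<and> k < length (xs @ [n])} = insert (length xs) {k. 0 < k \<and> k < length xs}"
    by auto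
  then have "(\<lambda>k. sum_list (take k (xs @ [n]))) ` {k. 0 < k \<and> k < length (xs @ [n])} =
      insert (sum_list xs) ((\<lambda>k. sum_list (take k xs)) ` {k. 0 < k \<and> k < length xs})"
    by auto
  then show ?thesis
    using assms False
    by (simp add: Des.rep_eq weight.rep_eq plus_composition.rep_eq parts_letter setcompr_eq_image xs_def)
qed

lemma signed_composition_eqI:
  assumes "weight I = Suc (length \<epsilon>)" "Des I = {Suc i | i. i < length \<epsilon> \<and> \<epsilon> ! i = Minus}"
  shows "signed_composition \<epsilon> = I"
  using assms by (intro Des_inj) (simp_all only: signed_composition)

lemma signed_composition_Nil: "signed_composition [] = letter 1"
  using Des_add_letter[of 1 0] by (intro signed_composition_eqI) simp_all

lemma Minus_positions_snoc:
  "{Suc i | i. i < length (\<epsilon> @ [s]) \<and> (\<epsilon> @ [s]) ! i = Minus} =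
    (if s = Minus then {Suc (length \<epsilon>)} else {}) \<union> {Suc i | i. i < length \<epsilon> \<and> \<epsilon> ! i = Minus}"
proof -
  have "{i. i < length (\<epsilon> @ [s]) \<and> (\<epsilon> @ [s]) ! i = Minus} =
      (if s = Minus then {length \<epsilon>} else {}) \<union> {i. i < length \<epsilon> \<and> \<epsilon> ! i = Minus}"
  proof (rule set_eqI)
    show "i \<in> {i. i < length (\<epsilon> @ [s]) \<and> (\<epsilon> @ [s]) ! i = Minus} \<longleftrightarrow>
        i \<in> (if s = Minus then {length \<epsilon>} else {}) \<union> {i. i < length \<epsilon> \<and> \<epsilon> ! i = Minus}" for i
      by (cases "i = length \<epsilon>") (simp_all add: nth_append less_Suc_eq)
  qed
  then show ?thesis
    by (simp add: setcompr_eq_image image_Un)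
qed

lemma signed_composition_neq_0 [simp]: "signed_composition \<epsilon> \<noteq> 0"
proof
  assume "signed_composition \<epsilon> = 0"
  then have "weight (signed_composition \<epsilon>) = 0" by simp
  then show False by (simp add: signed_composition)
qed

text \<open>Appending a minus sign starts a new part of size 1; appending a plus sign enlarges the last
  part.\<close>

lemma signed_composition_snoc_Minus:
  "signed_composition (\<epsilon> @ [Minus]) = signed_composition \<epsilon> + letter 1"
proof (rule signed_composition_eqI)
  show "weight (signed_composition \<epsilon> + letter 1) = Suc (length (\<epsilon> @ [Minus]))"
    by (simp add: signed_composition)
  show "Des (signed_composition \<epsilon> + letter 1) =
      {Suc i | i. i < length (\<epsilon> @ [Minus]) \<and> (\<epsilon> @ [Minus]) ! i = Minus}"
    unfolding Minus_positions_snoc by (simp add: signed_composition Des_add_letter)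
qed

lemma signed_composition_snoc_Plus:
  assumes "signed_composition \<epsilon> = J + letter n" "0 < n"
  shows "signed_composition (\<epsilon> @ [Plus]) = J + letter (Suc n)"
proof (intro signed_composition_eqI)
  show "weight (J + letter (Suc n)) = Suc (length (\<epsilon> @ [Plus]))"
    using signed_composition(1)[of \<epsilon>] assms by simp
  have "Des (J + letter (Suc n)) = Des (J + letter n)"
    using assms by (simp add: Des_add_letter)
  then show "Des (J + letter (Suc n)) =
      {Suc i | i. i < length (\<epsilon> @ [Plus]) \<and> (\<epsilon> @ [Plus]) ! i = Minus}"
    unfolding Minus_positions_snoc using signed_composition(2)[of \<epsilon>] assms by simp
qed

lemma signed_composition_surj:
  assumes "I \<noteq> 0"
  obtains \<epsilon> where "signed_composition \<epsilon> = I"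
proof -
  have "\<exists>\<epsilon>. signed_composition \<epsilon> = I"
    using assms
  proof (induction "weight I" arbitrary: I rule: less_induct)
    case less
    then obtain J n where I: "I = J + letter n" "0 < n"
      by (cases I rule: composition_snoc_cases) auto
    consider "n = 1" "J = 0" | "n = 1" "J \<noteq> 0" | m where "n = Suc m" "0 < m"
      using I by (cases n) auto
    then show ?case
    proof cases
      case 1
      then show ?thesis using I signed_composition_Nil by auto
    next
      case 2
      then obtain \<epsilon> where "signed_composition \<epsilon> = J" using less.hyps[of J] I by auto
      then show ?thesis using I 2 signed_composition_snoc_Minus by metis
    next
      case 3
      then obtain \<epsilon> where "signed_composition \<epsilon> = J + letter m"
        using less.hyps[of "J + letter m"] I by auto
      then show ?thesis using I 3 signed_composition_snoc_Plus by metis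
    qed
  qed
  then show ?thesis using that by blast
qed

lemma len_signed_composition: "len (signed_composition \<epsilon>) = Suc (count_list \<epsilon> Minus)"
proof (induction \<epsilon> rule: rev_induct)
  case Nil
  then show ?case using len_add_letter[of 1 0] by (simp add: signed_composition_Nil)
next
  case (snoc s \<epsilon>)
  obtain J n where J: "signed_composition \<epsilon> = J + letter n" "0 < n"
    by (cases "signed_composition \<epsilon>" rule: composition_snoc_cases) auto
  show ?case
  proof (cases s)
    case Plus
    have "len (signed_composition (\<epsilon> @ [Plus])) = len (J + letter n)"
      using J(2) by (simp only: signed_composition_snoc_Plus[OF J] len_add_letter zero_less_Suc)
    then show ?thesis using snoc J(1) Plus by simp
  next
    case Minus
    then show ?thesis using snoc signed_composition_snoc_Minus[of \<epsilon>] by simp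
  qed
qed

text \<open>The sign sequences of the refinements of the composition of \<open>\<epsilon>\<close>, among the sequences of the same
  length.\<close>

definition finer_signs :: "sign list \<Rightarrow> sign list set" where
  "finer_signs \<epsilon> = {\<delta>. list_all2 (\<lambda>s t. s = Minus \<longrightarrow> t = Minus) \<epsilon> \<delta>}"

lemma finite_sign_lists: "finite {\<epsilon> :: sign list. length \<epsilon> = n}"
proof -
  have "(UNIV :: sign set) = {Plus, Minus}"
    using sign.exhaust by auto
  then have "finite (UNIV :: sign set)"
    by (metis finite.emptyI finite_insert)
  then show ?thesis
    using finite_lists_length_eq[of "UNIV :: sign set" n] by simp
qed

lemma finite_finer_signs: "finite (finer_signs \<epsilon>)"
  by (rule finite_subset[OF _ finite_sign_lists[of "length \<epsilon>"]])
    (auto simp: finer_signs_def dest: list_all2_lengthD)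

lemma finer_signs_Nil [simp]: "finer_signs [] = {[]}"
  by (simp add: finer_signs_def)

lemma append_in_finer_signs_iff:
  "\<delta> @ [t] \<in> finer_signs (\<epsilon> @ [s]) \<longleftrightarrow> \<delta> \<in> finer_signs \<epsilon> \<and> (s = Minus \<longrightarrow> t = Minus)"
proof (cases "length \<delta> = length \<epsilon>")
  case True
  then show ?thesis by (simp add: finer_signs_def list_all2_append)
next
  case False
  then show ?thesis by (auto simp: finer_signs_def dest: list_all2_lengthD)
qed

lemma finer_signs_snoc_Plus:
  "finer_signs (\<epsilon> @ [Plus]) = (\<lambda>\<delta>. \<delta> @ [Plus]) ` finer_signs \<epsilon> \<union> (\<lambda>\<delta>. \<delta> @ [Minus]) ` finer_signs \<epsilon>"
proof (intro set_eqI iffI)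
  fix \<delta> assume \<delta>: "\<delta> \<in> finer_signs (\<epsilon> @ [Plus])"
  then obtain \<delta>' t where "\<delta> = \<delta>' @ [t]"
    by (cases \<delta> rule: rev_cases) (auto simp: finer_signs_def)
  with \<delta> show "\<delta> \<in> (\<lambda>\<delta>. \<delta> @ [Plus]) ` finer_signs \<epsilon> \<union> (\<lambda>\<delta>. \<delta> @ [Minus]) ` finer_signs \<epsilon>"
    by (cases t) (auto simp: append_in_finer_signs_iff)
qed (auto simp: append_in_finer_signs_iff)

lemma finer_signs_snoc_Minus:
  "finer_signs (\<epsilon> @ [Minus]) = (\<lambda>\<delta>. \<delta> @ [Minus]) ` finer_signs \<epsilon>"
proof (intro set_eqI iffI)
  fix \<delta> assume \<delta>: "\<delta> \<in> finer_signs (\<epsilon> @ [Minus])"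
  then obtain \<delta>' t where "\<delta> = \<delta>' @ [t]"
    by (cases \<delta> rule: rev_cases) (auto simp: finer_signs_def)
  with \<delta> show "\<delta> \<in> (\<lambda>\<delta>. \<delta> @ [Minus]) ` finer_signs \<epsilon>"
    by (auto simp: append_in_finer_signs_iff)
qed (auto simp: append_in_finer_signs_iff)

lemma sum_finer_signs_snoc_Plus:
  fixes F :: "sign list \<Rightarrow> real"
  shows "(\<Sum>\<delta>\<in>finer_signs (\<epsilon> @ [Plus]). F \<delta>) = (\<Sum>\<delta>\<in>finer_signs \<epsilon>. F (\<delta> @ [Plus]) + F (\<delta> @ [Minus]))"
  unfolding finer_signs_snoc_Plus
  by (subst sum.union_disjoint)
    (auto simp: finite_finer_signs sum.reindex inj_on_def sum.distrib)

lemma sum_finer_signs_snoc_Minus: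
  fixes F :: "sign list \<Rightarrow> real"
  shows "(\<Sum>\<delta>\<in>finer_signs (\<epsilon> @ [Minus]). F \<delta>) = (\<Sum>\<delta>\<in>finer_signs \<epsilon>. F (\<delta> @ [Minus]))"
  unfolding finer_signs_snoc_Minus by (simp add: sum.reindex inj_on_def)

lemma Suc_in_Des_signed_composition_iff:
  "Suc i \<in> Des (signed_composition \<epsilon>) \<longleftrightarrow> i < length \<epsilon> \<and> \<epsilon> ! i = Minus"
  unfolding signed_composition(2) by blast

lemma coarser_signed_composition_iff:
  assumes "length \<epsilon> = length \<delta>"
  shows "coarser (signed_composition \<epsilon>) (signed_composition \<delta>) \<longleftrightarrow> \<delta> \<in> finer_signs \<epsilon>"
proof -
  have "Des (signed_composition \<epsilon>) \<subseteq> Des (signed_composition \<delta>) \<longleftrightarrow>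
      (\<forall>i<length \<epsilon>. \<epsilon> ! i = Minus \<longrightarrow> \<delta> ! i = Minus)"
    unfolding signed_composition(2)[of \<epsilon>] using assms
    by (auto simp: subset_iff Suc_in_Des_signed_composition_iff)
  then show ?thesis
    using assms
    by (simp add: coarser_def signed_composition(1) finer_signs_def list_all2_conv_all_nth)
qed

lemma inj_signed_composition: "inj signed_composition"
proof (rule injI)
  fix \<epsilon> \<delta> assume eq: "signed_composition \<epsilon> = signed_composition \<delta>"
  then have len: "length \<epsilon> = length \<delta>"
    using signed_composition(1) by (metis Suc_inject)
  have "\<epsilon> ! i = Minus \<longleftrightarrow> \<delta> ! i = Minus" if "i < length \<epsilon>" for i
    using Suc_in_Des_signed_composition_iff[of i \<epsilon>] Suc_in_Des_signed_composition_iff[of i \<delta>] eq len that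
    by simp
  then have "\<epsilon> ! i = \<delta> ! i" if "i < length \<epsilon>" for i
    using that by (metis (full_types) sign.exhaust)
  then show "\<epsilon> = \<delta>"
    using len by (simp add: list_eq_iff_nth_eq)
qed

lemma bij_betw_signed_composition:
  assumes "0 < n"
  shows "bij_betw signed_composition {\<epsilon>. length \<epsilon> = n - 1} {J. weight J = n}"
  unfolding bij_betw_def
proof (intro conjI set_eqI iffI)
  show "inj_on signed_composition {\<epsilon>. length \<epsilon> = n - 1}"
    using inj_signed_composition by (rule inj_on_subset) simp
  fix J assume "J \<in> {J. weight J = n}"
  moreover from this obtain \<epsilon> where "signed_composition \<epsilon> = J"
    using assms by (cases "J = 0") (auto intro: signed_composition_surj)
  ultimately show "J \<in> signed_composition ` {\<epsilon>. length \<epsilon> = n - 1}"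
    using signed_composition(1)[of \<epsilon>] by auto
qed (use assms in \<open>auto simp: signed_composition\<close>)

lemma S_word_signed_composition:
  "S_word (signed_composition \<delta>) = (\<Sum>\<epsilon> | length \<epsilon> = length \<delta> \<and> \<delta> \<in> finer_signs \<epsilon>. ribbon (signed_composition \<epsilon>))"
proof -
  have "{J. coarser J (signed_composition \<delta>)} =
      signed_composition ` {\<epsilon>. length \<epsilon> = length \<delta> \<and> \<delta> \<in> finer_signs \<epsilon>}" (is "?L = ?R")
  proof (intro set_eqI iffI)
    fix J assume J: "J \<in> ?L"
    then have "weight J = Suc (length \<delta>)" by (simp add: coarser_def signed_composition)
    moreover from this obtain \<epsilon> where "signed_composition \<epsilon> = J"
      by (cases "J = 0") (auto intro: signed_composition_surj)
    ultimately show "J \<in> ?R"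
      using J signed_composition(1)[of \<epsilon>] coarser_signed_composition_iff[of \<epsilon> \<delta>] by auto
  qed (auto simp: coarser_signed_composition_iff)
  then show ?thesis
    using inj_on_subset[OF inj_signed_composition subset_UNIV]
    by (simp only: S_word_ribbon sum.reindex o_def)
qed

text \<open>Write every word as a sum of ribbons and exchange the two sums. Going from words to ribbons,
  rather than back, makes a sum over refinements appear instead of an alternating sum over
  coarsenings.\<close>

lemma ribbon_series_eq_S_series:
  assumes c: "\<And>\<epsilon>. c \<epsilon> = (-1) ^ count_list \<epsilon> Minus * (\<Sum>\<delta>\<in>finer_signs \<epsilon>. w (signed_composition \<delta>))"
    and n: "0 < n"
  shows "ribbon_series c n = S_series w n"
proof -
  define E where "E = {\<epsilon> :: sign list. length \<epsilon> = n - 1}"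
  have fin: "finite E" unfolding E_def by (rule finite_sign_lists)
  have "S_series w n = (\<Sum>\<delta>\<in>E. w (signed_composition \<delta>) *\<^sub>R S_word (signed_composition \<delta>))"
    unfolding S_series_def E_def
    by (rule sum.reindex_bij_betw[OF bij_betw_signed_composition[OF n], symmetric])
  also have "\<dots> = (\<Sum>\<delta>\<in>E. \<Sum>\<epsilon>\<in>E. if \<delta> \<in> finer_signs \<epsilon> then
      w (signed_composition \<delta>) *\<^sub>R ribbon (signed_composition \<epsilon>) else 0)"
  proof (intro sum.cong refl)
    fix \<delta> assume "\<delta> \<in> E"
    then have "{\<epsilon>. length \<epsilon> = length \<delta> \<and> \<delta> \<in> finer_signs \<epsilon>} = {\<epsilon> \<in> E. \<delta> \<in> finer_signs \<epsilon>}"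
      by (auto simp: E_def)
    then show "w (signed_composition \<delta>) *\<^sub>R S_word (signed_composition \<delta>) =
        (\<Sum>\<epsilon>\<in>E. if \<delta> \<in> finer_signs \<epsilon> then w (signed_composition \<delta>) *\<^sub>R ribbon (signed_composition \<epsilon>) else 0)"
      by (simp only: S_word_signed_composition scaleR_sum_right sum.inter_filter[OF fin]
          if_distrib[of "(*\<^sub>R) (w (signed_composition \<delta>))"] scaleR_zero_right)
  qed
  also have "\<dots> = (\<Sum>\<epsilon>\<in>E. \<Sum>\<delta>\<in>E. if \<delta> \<in> finer_signs \<epsilon> then
      w (signed_composition \<delta>) *\<^sub>R ribbon (signed_composition \<epsilon>) else 0)"
    by (rule sum.swap)
  also have "\<dots> = (\<Sum>\<epsilon>\<in>E. c \<epsilon> *\<^sub>R signed_ribbon \<epsilon>)"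
  proof (intro sum.cong refl)
    fix \<epsilon> assume "\<epsilon> \<in> E"
    then have "finer_signs \<epsilon> = {\<delta> \<in> E. \<delta> \<in> finer_signs \<epsilon>}"
      by (auto simp: E_def finer_signs_def dest: list_all2_lengthD)
    from arg_cong[OF this, of "sum (\<lambda>\<delta>. w (signed_composition \<delta>) *\<^sub>R ribbon (signed_composition \<epsilon>))"]
    have "(\<Sum>\<delta>\<in>E. if \<delta> \<in> finer_signs \<epsilon> then
        w (signed_composition \<delta>) *\<^sub>R ribbon (signed_composition \<epsilon>) else 0) =
        (\<Sum>\<delta>\<in>finer_signs \<epsilon>. w (signed_composition \<delta>)) *\<^sub>R ribbon (signed_composition \<epsilon>)"
      by (simp only: scaleR_sum_left sum.inter_filter[OF fin])
    also have "\<dots> = c \<epsilon> *\<^sub>R signed_ribbon \<epsilon>"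
      by (simp add: c signed_ribbon_def len_signed_composition flip: power_add mult_2 power_mult)
    finally show "(\<Sum>\<delta>\<in>E. if \<delta> \<in> finer_signs \<epsilon> then
        w (signed_composition \<delta>) *\<^sub>R ribbon (signed_composition \<epsilon>) else 0) = c \<epsilon> *\<^sub>R signed_ribbon \<epsilon>" .
  qed
  finally show ?thesis using n by (simp add: ribbon_series_def E_def)
qed

section \<open>Bounded Borel functions of one and two variables\<close>

definition bdd_borel :: "(real \<Rightarrow> real) set" where
  "bdd_borel = {h \<in> borel_measurable borel. \<exists>K. \<forall>x. \<bar>h x\<bar> \<le> K}"

text \<open>Test functions of the positions of two walks. Joint measurability is what Fubini's theorem
  needs; the curried form lets an operator act on either variable.\<close>

definition bdd_borel2 :: "(real \<Rightarrow> real \<Rightarrow> real) set" where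
  "bdd_borel2 = {H. case_prod H \<in> borel_measurable (borel \<Otimes>\<^sub>M borel) \<and> (\<exists>K. \<forall>x y. \<bar>H x y\<bar> \<le> K)}"

lemma bdd_borel2_swap: "H \<in> bdd_borel2 \<Longrightarrow> (\<lambda>s t. H t s) \<in> bdd_borel2"
  unfolding bdd_borel2_def by (auto intro: measurable_pair_swap[of _ borel borel borel, simplified])

lemma bdd_borel2_slice:
  assumes "H \<in> bdd_borel2"
  shows "H s \<in> bdd_borel"
proof -
  have "(\<lambda>t. case_prod H (s, t)) \<in> borel_measurable borel"
    using assms unfolding bdd_borel2_def by (intro measurable_compose[OF measurable_Pair1']) auto
  then show ?thesis using assms by (auto simp: bdd_borel_def bdd_borel2_def)
qed

lemma bdd_borel2_slice': "H \<in> bdd_borel2 \<Longrightarrow> (\<lambda>s. H s t) \<in> bdd_borel"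
  using bdd_borel2_slice[OF bdd_borel2_swap] .

lemma bdd_borel_const [simp]: "(\<lambda>_. c) \<in> bdd_borel"
  by (auto simp: bdd_borel_def)

lemma bdd_borel2_add:
  assumes "H \<in> bdd_borel2" "K \<in> bdd_borel2"
  shows "(\<lambda>s t. H s t + K s t) \<in> bdd_borel2"
proof -
  obtain a b where ab: "\<And>s t. \<bar>H s t\<bar> \<le> a" "\<And>s t. \<bar>K s t\<bar> \<le> b"
    using assms by (auto simp: bdd_borel2_def)
  have "\<bar>H s t + K s t\<bar> \<le> a + b" for s t
    using ab[of s t] by linarith
  moreover have "case_prod (\<lambda>s t. H s t + K s t) \<in> borel_measurable (borel \<Otimes>\<^sub>M borel)"
    using assms by (auto simp: bdd_borel2_def case_prod_unfold intro: borel_measurable_add)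
  ultimately show ?thesis by (auto simp: bdd_borel2_def)
qed

lemma bdd_borel2_mult:
  assumes "h \<in> bdd_borel" "k \<in> bdd_borel"
  shows "(\<lambda>s t. h s * k t) \<in> bdd_borel2"
proof -
  have [measurable]: "h \<in> borel_measurable borel" "k \<in> borel_measurable borel"
    using assms by (auto simp: bdd_borel_def)
  obtain a b where ab: "\<And>s. \<bar>h s\<bar> \<le> a" "\<And>t. \<bar>k t\<bar> \<le> b"
    using assms by (auto simp: bdd_borel_def)
  have "\<bar>h s * k t\<bar> \<le> a * b" for s t
    unfolding abs_mult using ab(1)[of s] ab(2)[of t] by (intro mult_mono) auto
  then show ?thesis by (auto simp: bdd_borel2_def)
qed

lemma bdd_borel_mult:
  assumes "h \<in> bdd_borel" "k \<in> bdd_borel"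
  shows "(\<lambda>x. h x * k x) \<in> bdd_borel"
proof -
  obtain a b where ab: "\<And>s. \<bar>h s\<bar> \<le> a" "\<And>t. \<bar>k t\<bar> \<le> b"
    using assms by (auto simp: bdd_borel_def)
  have "\<bar>h s * k s\<bar> \<le> a * b" for s
    unfolding abs_mult using ab(1)[of s] ab(2)[of s] by (intro mult_mono) auto
  then show ?thesis using assms by (auto simp: bdd_borel_def)
qed

lemma bdd_borel2_sum_arg:
  assumes "h \<in> bdd_borel"
  shows "(\<lambda>s t. h (s + t)) \<in> bdd_borel2"
proof -
  have [measurable]: "h \<in> borel_measurable borel" using assms by (auto simp: bdd_borel_def)
  show ?thesis using assms by (auto simp: bdd_borel2_def bdd_borel_def)
qed

text \<open>The sign turns the projection onto functions supported on the negative half-line, a Rota-Baxter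
  operator of weight \<open>-1\<close>, into one of weight 1. It also accounts for the sign
  \<open>(-1)\<^bsup>\<ell>(I)-1\<^esup>\<close> of a signed ribbon.\<close>

definition neg_restrict :: "(real \<Rightarrow> real) \<Rightarrow> real \<Rightarrow> real" where
  "neg_restrict h s = (if s < 0 then - h s else 0)"

lemma neg_restrict_bdd_borel2:
  assumes "H \<in> bdd_borel2"
  shows "(\<lambda>s t. neg_restrict (H s) t) \<in> bdd_borel2"
proof -
  have [measurable]: "case_prod H \<in> borel_measurable (borel \<Otimes>\<^sub>M borel)"
    using assms by (simp add: bdd_borel2_def)
  have "case_prod (\<lambda>s t. neg_restrict (H s) t) =
    (\<lambda>p. if snd p < 0 then - case_prod H p else 0)"
    by (auto simp: neg_restrict_def)
  then have "case_prod (\<lambda>s t. neg_restrict (H s) t) \<in> borel_measurable (borel \<Otimes>\<^sub>M borel)"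
    by simp
  moreover have "\<exists>K. \<forall>s t. \<bar>neg_restrict (H s) t\<bar> \<le> K"
  proof -
    obtain K where K: "\<And>s t. \<bar>H s t\<bar> \<le> K" using assms by (auto simp: bdd_borel2_def)
    then have "0 \<le> K" by (meson abs_ge_zero order_trans)
    with K show ?thesis by (auto simp: neg_restrict_def)
  qed
  ultimately show ?thesis by (simp add: bdd_borel2_def)
qed

lemma bdd_borel_iff_const_bdd_borel2: "h \<in> bdd_borel \<longleftrightarrow> (\<lambda>_. h) \<in> bdd_borel2"
proof
  assume "h \<in> bdd_borel"
  then show "(\<lambda>_. h) \<in> bdd_borel2" using bdd_borel2_mult[of "\<lambda>_. 1" h] by simp
qed (rule bdd_borel2_slice)

section \<open>Walk operators\<close>

text \<open>The density may take both signs. Its boundedness everywhere, not just almost everywhere, is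
  there to make its reflection a bounded test function.\<close>

locale bounded_density =
  fixes g :: "real \<Rightarrow> real" and C :: real
  assumes borel_g [measurable]: "g \<in> borel_measurable borel"
    and integrable_g: "integrable lborel g"
    and g_le: "\<bar>g x\<bar> \<le> C"
begin

definition step :: "(real \<Rightarrow> real) \<Rightarrow> real \<Rightarrow> real" where
  "step h s = (\<integral>x. g x * h (s + x) \<partial>lborel)"

lemma integrable_step:
  assumes "h \<in> bdd_borel"
  shows "integrable lborel (\<lambda>x. g x * h (s + x))"
proof -
  have [measurable]: "h \<in> borel_measurable borel" using assms by (auto simp: bdd_borel_def)
  obtain K where K: "\<And>x. \<bar>h x\<bar> \<le> K" using assms by (auto simp: bdd_borel_def)
  have "integrable lborel (\<lambda>x. K * g x)" using integrable_g by simp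
  then show ?thesis
  proof (rule Bochner_Integration.integrable_bound)
    show "AE x in lborel. norm (g x * h (s + x)) \<le> norm (K * g x)"
    proof (rule AE_I2)
      fix x
      have "\<bar>h (s + x)\<bar> \<le> \<bar>K\<bar>" using K[of "s + x"] by linarith
      then show "norm (g x * h (s + x)) \<le> norm (K * g x)"
        using mult_right_mono[of "\<bar>h (s + x)\<bar>" "\<bar>K\<bar>" "\<bar>g x\<bar>"] by (simp add: abs_mult mult.commute)
    qed
  qed simp
qed

lemma step_linear:
  assumes "h \<in> bdd_borel" "k \<in> bdd_borel"
  shows "step (\<lambda>x. a * h x + b * k x) s = a * step h s + b * step k s"
proof -
  have "step (\<lambda>x. a * h x + b * k x) s =
      (\<integral>x. a * (g x * h (s + x)) + b * (g x * k (s + x)) \<partial>lborel)"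
    unfolding step_def by (intro Bochner_Integration.integral_cong refl) (simp add: algebra_simps)
  then show ?thesis
    using integrable_step[OF assms(1)] integrable_step[OF assms(2)] by (simp add: step_def)
qed

lemma step_bdd_borel2:
  assumes "H \<in> bdd_borel2"
  shows "(\<lambda>s t. step (H s) t) \<in> bdd_borel2"
proof -
  have H[measurable]: "case_prod H \<in> borel_measurable (borel \<Otimes>\<^sub>M borel)"
    using assms by (simp add: bdd_borel2_def)
  obtain K where K: "\<And>s t. \<bar>H s t\<bar> \<le> K" using assms by (auto simp: bdd_borel2_def)
  have "case_prod (\<lambda>s t. step (H s) t) = (\<lambda>p. \<integral>x. g x * case_prod H (fst p, snd p + x) \<partial>lborel)"
    by (auto simp: step_def)
  moreover have "\<dots> \<in> borel_measurable (borel \<Otimes>\<^sub>M borel)"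
    by measurable
  ultimately have meas: "case_prod (\<lambda>s t. step (H s) t) \<in> borel_measurable (borel \<Otimes>\<^sub>M borel)"
    by (simp only:)
  have "\<bar>step (H s) t\<bar> \<le> K * (\<integral>x. \<bar>g x\<bar> \<partial>lborel)" for s t
  proof -
    have "\<bar>step (H s) t\<bar> \<le> (\<integral>x. \<bar>g x * H s (t + x)\<bar> \<partial>lborel)"
      unfolding step_def using integral_norm_bound[of lborel "\<lambda>x. g x * H s (t + x)"] by simp
    also have "\<dots> \<le> (\<integral>x. K * \<bar>g x\<bar> \<partial>lborel)"
    proof (rule integral_mono)
      show "integrable lborel (\<lambda>x. \<bar>g x * H s (t + x)\<bar>)"
        by (rule integrable_abs, rule integrable_step[OF bdd_borel2_slice[OF assms]])
      show "integrable lborel (\<lambda>x. K * \<bar>g x\<bar>)"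
        using integrable_g by simp
      show "\<bar>g x * H s (t + x)\<bar> \<le> K * \<bar>g x\<bar>" for x
        using mult_right_mono[OF K[of s "t + x"], of "\<bar>g x\<bar>"] by (simp add: abs_mult mult.commute)
    qed
    finally show ?thesis by simp
  qed
  with meas show ?thesis unfolding bdd_borel2_def by blast
qed

text \<open>Steps of two independent walks can be averaged in either order.\<close>

lemma step_commute:
  assumes "H \<in> bdd_borel2"
  shows "step (\<lambda>s. step (\<lambda>t. H s t) y) x = step (\<lambda>t. step (\<lambda>s. H s t) x) y"
proof -
  have H[measurable]: "case_prod H \<in> borel_measurable (borel \<Otimes>\<^sub>M borel)"
    using assms by (simp add: bdd_borel2_def)
  obtain K where K: "\<And>s t. \<bar>H s t\<bar> \<le> K" using assms by (auto simp: bdd_borel2_def)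
  define F where "F u v = g u * (g v * case_prod H (x + u, y + v))" for u v
  have [measurable]: "case_prod F \<in> borel_measurable (lborel \<Otimes>\<^sub>M lborel)"
    unfolding F_def case_prod_unfold by simp
  have slice: "integrable lborel (F u)" for u
  proof -
    have "F u = (\<lambda>v. g u * (g v * H (x + u) (y + v)))"
      by (auto simp: F_def)
    then show ?thesis
      using integrable_step[OF bdd_borel2_slice[OF assms], of "x + u" y] by simp
  qed
  have "integrable (lborel \<Otimes>\<^sub>M lborel) (case_prod F)"
  proof (rule lborel_pair.Fubini_integrable)
    have "integrable lborel (\<lambda>u. \<bar>g u\<bar> * (K * (\<integral>v. \<bar>g v\<bar> \<partial>lborel)))"
      using integrable_g by simp
    then show "integrable lborel (\<lambda>u. \<integral>v. norm (case_prod F (u, v)) \<partial>lborel)"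
    proof (rule Bochner_Integration.integrable_bound)
      have "norm (\<integral>v. norm (F u v) \<partial>lborel) \<le> norm (\<bar>g u\<bar> * (K * (\<integral>v. \<bar>g v\<bar> \<partial>lborel)))" for u
      proof -
        have "norm (\<integral>v. norm (F u v) \<partial>lborel) = (\<integral>v. norm (F u v) \<partial>lborel)"
          by simp
        also have "\<dots> \<le> (\<integral>v. \<bar>g u\<bar> * (K * \<bar>g v\<bar>) \<partial>lborel)"
        proof (rule integral_mono)
          show "integrable lborel (\<lambda>v. norm (F u v))"
            using slice by (rule integrable_norm)
          show "integrable lborel (\<lambda>v. \<bar>g u\<bar> * (K * \<bar>g v\<bar>))"
            using integrable_g by simp
          show "norm (F u v) \<le> \<bar>g u\<bar> * (K * \<bar>g v\<bar>)" for v
            using mult_right_mono[OF K[of "x + u" "y + v"], of "\<bar>g v\<bar>"]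
            by (auto simp: F_def abs_mult mult.commute intro!: mult_left_mono)
        qed
        also have "\<dots> = \<bar>g u\<bar> * (K * (\<integral>v. \<bar>g v\<bar> \<partial>lborel))"
          by simp
        finally show ?thesis by simp
      qed
      then show "AE u in lborel. norm (\<integral>v. norm (case_prod F (u, v)) \<partial>lborel) \<le>
          norm (\<bar>g u\<bar> * (K * (\<integral>v. \<bar>g v\<bar> \<partial>lborel)))"
        by simp
    qed measurable
  qed (use slice in auto)
  then have "(\<integral>v. \<integral>u. F u v \<partial>lborel \<partial>lborel) = (\<integral>u. \<integral>v. F u v \<partial>lborel \<partial>lborel)"
    by (rule lborel_pair.Fubini_integral)
  then show ?thesis by (simp add: F_def step_def algebra_simps)
qed

text \<open>The words in \<open>step\<close> and \<open>neg_restrict\<close>. Every analytic property of an operator word that is used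
  later (it preserves test functions, is linear, and commutes with words acting on another
  variable) follows by induction from the same property of the two letters.\<close>

inductive_set walk_ops :: "((real \<Rightarrow> real) \<Rightarrow> real \<Rightarrow> real) set" where
  walk_ops_id: "id \<in> walk_ops"
| walk_ops_step_comp: "A \<in> walk_ops \<Longrightarrow> step \<circ> A \<in> walk_ops"
| walk_ops_neg_comp: "A \<in> walk_ops \<Longrightarrow> neg_restrict \<circ> A \<in> walk_ops"

lemma walk_ops_comp: "A \<in> walk_ops \<Longrightarrow> B \<in> walk_ops \<Longrightarrow> A \<circ> B \<in> walk_ops"
  by (induction rule: walk_ops.induct) (simp_all add: comp_assoc walk_ops.intros)

lemma walk_ops_step: "step \<in> walk_ops"
  using walk_ops_step_comp[OF walk_ops_id] by simp

lemma walk_ops_neg_restrict: "neg_restrict \<in> walk_ops"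
  using walk_ops_neg_comp[OF walk_ops_id] by simp

lemma walk_ops_funpow: "A \<in> walk_ops \<Longrightarrow> A ^^ j \<in> walk_ops"
  by (induction j) (simp_all add: walk_ops_id walk_ops_comp)

lemma walk_ops_bdd_borel2: "A \<in> walk_ops \<Longrightarrow> H \<in> bdd_borel2 \<Longrightarrow> (\<lambda>s t. A (H s) t) \<in> bdd_borel2"
proof (induction rule: walk_ops.induct)
  case (walk_ops_step_comp A)
  then show ?case using step_bdd_borel2[of "\<lambda>s. A (H s)"] by simp
next
  case (walk_ops_neg_comp A)
  then show ?case using neg_restrict_bdd_borel2[of "\<lambda>s. A (H s)"] by simp
qed simp

lemma walk_ops_bdd_borel2': "A \<in> walk_ops \<Longrightarrow> H \<in> bdd_borel2 \<Longrightarrow> (\<lambda>s t. A (\<lambda>s. H s t) s) \<in> bdd_borel2"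
  using walk_ops_bdd_borel2[of A "\<lambda>t s. H s t"] bdd_borel2_swap[of H]
    bdd_borel2_swap[of "\<lambda>t s. A (\<lambda>s. H s t) s"] by blast

lemma walk_ops_bdd_borel: "A \<in> walk_ops \<Longrightarrow> h \<in> bdd_borel \<Longrightarrow> A h \<in> bdd_borel"
  using walk_ops_bdd_borel2[of A "\<lambda>_. h"] by (simp add: bdd_borel_iff_const_bdd_borel2)

lemma walk_ops_linear:
  assumes "A \<in> walk_ops" "h \<in> bdd_borel" "k \<in> bdd_borel"
  shows "A (\<lambda>x. a * h x + b * k x) = (\<lambda>x. a * A h x + b * A k x)"
  using assms
proof (induction rule: walk_ops.induct)
  case (walk_ops_step_comp A)
  then show ?case by (auto simp: walk_ops_bdd_borel step_linear)
qed (auto simp: neg_restrict_def)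

lemma walk_ops_add:
  assumes "A \<in> walk_ops" "h \<in> bdd_borel" "k \<in> bdd_borel"
  shows "A (\<lambda>x. h x + k x) = (\<lambda>x. A h x + A k x)"
  using walk_ops_linear[OF assms, of 1 1] by simp

lemma walk_ops_scale:
  assumes "A \<in> walk_ops" "h \<in> bdd_borel"
  shows "A (\<lambda>x. c * h x) = (\<lambda>x. c * A h x)"
  using walk_ops_linear[OF assms(1,2,2), of c 0] by simp

lemma walk_ops_step_commute:
  assumes "A \<in> walk_ops" "H \<in> bdd_borel2"
  shows "A (\<lambda>s. step (\<lambda>t. H s t) y) x = step (\<lambda>t. A (\<lambda>s. H s t) x) y"
  using assms
proof (induction arbitrary: x rule: walk_ops.induct)
  case (walk_ops_step_comp A)
  then show ?case
  proof -
    have "A (\<lambda>s. step (\<lambda>t. H s t) y) = (\<lambda>x. step (\<lambda>t. A (\<lambda>s. H s t) x) y)"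
      using walk_ops_step_comp by (intro ext) simp
    then show ?thesis
      using step_commute[OF walk_ops_bdd_borel2'[OF walk_ops_step_comp(1) walk_ops_step_comp(3)], of y x] by simp
  qed
next
  case (walk_ops_neg_comp A)
  then show ?case
    by (simp add: neg_restrict_def step_def)
qed simp

text \<open>Words acting on different variables commute. For two steps this is Fubini's theorem;
  \<open>neg_restrict\<close> multiplies by a number that is constant in the other variable, so for it linearity
  suffices.\<close>

lemma walk_ops_commute:
  assumes "A \<in> walk_ops" "B \<in> walk_ops" "H \<in> bdd_borel2"
  shows "A (\<lambda>s. B (\<lambda>t. H s t) y) x = B (\<lambda>t. A (\<lambda>s. H s t) x) y"
  using assms(2)
proof (induction arbitrary: y rule: walk_ops.induct)
  case (walk_ops_step_comp B)
  then show ?case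
    using walk_ops_step_commute[OF assms(1) walk_ops_bdd_borel2[OF walk_ops_step_comp(1) assms(3)]] by simp
next
  case (walk_ops_neg_comp B)
  have *: "(\<lambda>s. B (H s) y) \<in> bdd_borel"
    by (rule bdd_borel2_slice'[OF walk_ops_bdd_borel2[OF walk_ops_neg_comp(1) assms(3)]])
  show ?case
    using walk_ops_scale[OF assms(1) *, of "-1"] walk_ops_scale[OF assms(1) *, of 0] walk_ops_neg_comp(2)
    by (simp add: neg_restrict_def)
qed simp

text \<open>Averaging over a step commutes with translation. Hence on a function of \<open>s + t\<close> a step of either
  walk has the same effect.\<close>

lemma step_translate: "step (\<lambda>x. h (x + t)) = (\<lambda>s. step h (s + t))" "step (\<lambda>x. h (t + x)) = (\<lambda>s. step h (t + s))"
  by (simp_all add: step_def fun_eq_iff algebra_simps)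

lemma funpow_step_translate:
  "(step ^^ j) (\<lambda>x. h (x + t)) = (\<lambda>s. (step ^^ j) h (s + t))"
  "(step ^^ j) (\<lambda>x. h (t + x)) = (\<lambda>s. (step ^^ j) h (t + s))"
  by (induction j) (simp_all add: step_translate)

end

context bounded_density begin

section \<open>Quasi-shuffle products of walk weights\<close>

definition word_list_op :: "nat list \<Rightarrow> (real \<Rightarrow> real) \<Rightarrow> real \<Rightarrow> real" where
  "word_list_op js h = foldr (\<lambda>j k. (step ^^ j) (neg_restrict k)) js h"

text \<open>For \<open>J = (j\<^sub>1, \<dots>, j\<^sub>r)\<close> this is \<open>U\<^bsup>j\<^sub>1\<^esup> N \<dots> U\<^bsup>j\<^sub>r\<^esup> N\<close>. Applied to the constant 1 and evaluated at
  0, it gives \<open>(-1)\<^sup>r\<close> times the integral over the walks whose partial sums at the ends of the \<open>r\<close>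
  parts are negative.\<close>

definition word_op :: "composition \<Rightarrow> (real \<Rightarrow> real) \<Rightarrow> real \<Rightarrow> real" where
  "word_op J = word_list_op (parts J)"

text \<open>The last factor \<open>U\<^bsup>j\<^sub>r\<^esup> N\<close> of the operator word is replaced by \<open>U\<^bsup>j\<^sub>r - 1\<^esup>\<close>, applied to \<open>h\<close>. The
  function \<open>h\<close> stands for \<open>U k\<close> with \<open>k\<close> the condition imposed at the end of the walk. Giving \<open>U k\<close>
  instead of \<open>k\<close> covers the Dirac mass, for which \<open>U k\<close> is the reflected density, a genuine
  function. The empty composition receives the value \<open>z\<close>.\<close>

definition terminal_weight :: "real \<Rightarrow> (real \<Rightarrow> real) \<Rightarrow> composition \<Rightarrow> real" where
  "terminal_weight z h J = (if J = 0 then z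
     else word_list_op (butlast (parts J)) ((step ^^ (last (parts J) - 1)) h) 0)"

lemma word_op_0 [simp]: "word_op 0 h = h"
  by (simp add: word_op_def word_list_op_def zero_composition.rep_eq)

lemma word_op_snoc: "0 < j \<Longrightarrow> word_op (J + letter j) = word_op J \<circ> (step ^^ j \<circ> neg_restrict)"
  by (simp add: fun_eq_iff word_op_def word_list_op_def plus_composition.rep_eq parts_letter)

lemma terminal_weight_0 [simp]: "terminal_weight z h 0 = z"
  by (simp add: terminal_weight_def)

lemma terminal_weight_snoc: "0 < j \<Longrightarrow> terminal_weight z h (J + letter j) = word_op J ((step ^^ (j - 1)) h) 0"
  by (simp add: terminal_weight_def word_op_def plus_composition.rep_eq parts_letter)

lemma word_op_in_ops: "word_op J \<in> walk_ops"
proof (induction J rule: composition_snoc_induct)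
  case zero
  have "word_op 0 = id" by (simp add: fun_eq_iff)
  then show ?case using walk_ops_id by metis
next
  case (snoc J j)
  show ?case
    unfolding word_op_snoc[OF snoc(2)]
    by (rule walk_ops_comp[OF snoc(1) walk_ops_comp[OF walk_ops_funpow[OF walk_ops_step] walk_ops_neg_restrict]])
qed

lemma step_in_bdd_borel: "h \<in> bdd_borel \<Longrightarrow> step h \<in> bdd_borel"
  by (rule walk_ops_bdd_borel[OF walk_ops_step])

lemma neg_restrict_in_bdd_borel: "h \<in> bdd_borel \<Longrightarrow> neg_restrict h \<in> bdd_borel"
  by (rule walk_ops_bdd_borel[OF walk_ops_neg_restrict])

lemma funpow_step_in_bdd_borel: "h \<in> bdd_borel \<Longrightarrow> (step ^^ j) h \<in> bdd_borel"
  by (rule walk_ops_bdd_borel[OF walk_ops_funpow[OF walk_ops_step]])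

text \<open>The first operator acts on the first variable and the second on the second one.\<close>

definition act2 :: "((real \<Rightarrow> real) \<Rightarrow> real \<Rightarrow> real) \<Rightarrow> ((real \<Rightarrow> real) \<Rightarrow> real \<Rightarrow> real) \<Rightarrow>
    (real \<Rightarrow> real \<Rightarrow> real) \<Rightarrow> real \<Rightarrow> real \<Rightarrow> real" where
  "act2 A B H s t = A (\<lambda>s. B (H s) t) s"

lemma act2_bdd_borel2: "A \<in> walk_ops \<Longrightarrow> B \<in> walk_ops \<Longrightarrow> H \<in> bdd_borel2 \<Longrightarrow> act2 A B H \<in> bdd_borel2"
  using walk_ops_bdd_borel2'[of A "\<lambda>s t. B (H s) t"] walk_ops_bdd_borel2[of B H]
  by (simp add: act2_def[abs_def])

lemma act2_add:
  assumes "A \<in> walk_ops" "B \<in> walk_ops" "H \<in> bdd_borel2" "K \<in> bdd_borel2"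
  shows "act2 A B (\<lambda>s t. H s t + K s t) s t = act2 A B H s t + act2 A B K s t"
proof -
  have "B (\<lambda>t. H s t + K s t) t = B (H s) t + B (K s) t" for s
    using walk_ops_add[OF assms(2) bdd_borel2_slice[OF assms(3)] bdd_borel2_slice[OF assms(4)]]
    by (simp add: fun_eq_iff)
  then show ?thesis
    using walk_ops_add[OF assms(1) bdd_borel2_slice'[OF walk_ops_bdd_borel2[OF assms(2,3)]]
        bdd_borel2_slice'[OF walk_ops_bdd_borel2[OF assms(2,4)]]]
    by (simp add: act2_def fun_eq_iff)
qed

lemma act2_act2:
  assumes "B \<in> walk_ops" "A' \<in> walk_ops" "B' \<in> walk_ops" "H \<in> bdd_borel2"
  shows "act2 A B (act2 A' B' H) = act2 (A \<circ> A') (B \<circ> B') H"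
proof (intro ext)
  fix s t
  have "B (\<lambda>t. A' (\<lambda>s. B' (H s) t) s) t = A' (\<lambda>s. B (B' (H s)) t) s" for s
    using walk_ops_commute[OF assms(2) assms(1) walk_ops_bdd_borel2[OF assms(3,4)]] by simp
  then show "act2 A B (act2 A' B' H) s t = act2 (A \<circ> A') (B \<circ> B') H s t"
    by (simp add: act2_def[abs_def])
qed

lemma act2_mult:
  assumes "A \<in> walk_ops" "B \<in> walk_ops" "h \<in> bdd_borel" "k \<in> bdd_borel"
  shows "act2 A B (\<lambda>s t. h s * k t) s t = A h s * B k t"
  using walk_ops_scale[OF assms(2,4)] walk_ops_scale[OF assms(1,3), of "B k t"]
  by (simp add: act2_def fun_eq_iff mult.commute)

text \<open>On functions of the sum of the two positions, the steps of both walks accumulate.\<close>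

lemma act2_funpow_step:
  "act2 (step ^^ i) (step ^^ j) (\<lambda>s t. h (s + t)) = (\<lambda>s t. (step ^^ (i + j)) h (s + t))"
proof (intro ext)
  fix s t
  show "act2 (step ^^ i) (step ^^ j) (\<lambda>s t. h (s + t)) s t = (step ^^ (i + j)) h (s + t)"
    unfolding act2_def funpow_step_translate(2)[of j h]
      funpow_step_translate(1)[of i "(step ^^ j) h" t] funpow_add
    by simp
qed

text \<open>With \<open>h = U k\<close> this is \<open>U\<^sub>1 U\<^sub>2 (N\<^sub>1 + N\<^sub>2 + 1)\<close> applied to \<open>k(s + t)\<close>; see \<open>merge_defect_step\<close>
  below. It collects what the three possible last parts of a quasi-shuffle contribute once their
  common outer factors have been removed.\<close>

definition merge_defect :: "(real \<Rightarrow> real) \<Rightarrow> real \<Rightarrow> real \<Rightarrow> real" where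
  "merge_defect h s t = step (neg_restrict (\<lambda>t. h (s + t))) t + step (neg_restrict (\<lambda>s. h (s + t))) s + step h (s + t)"

lemma merge_defect_act2:
  "merge_defect h s t = act2 id (step \<circ> neg_restrict) (\<lambda>s t. h (s + t)) s t +
    act2 (step \<circ> neg_restrict) id (\<lambda>s t. h (s + t)) s t + act2 step id (\<lambda>s t. h (s + t)) s t"
  using act2_funpow_step[of 1 0 h] by (simp add: merge_defect_def act2_def id_def fun_eq_iff)

lemma funpow_step_Suc: "0 < j \<Longrightarrow> step ^^ j = (step ^^ (j - 1)) \<circ> step"
  by (cases j) (simp_all add: funpow_Suc_right del: funpow.simps)

text \<open>The formula for operator words of smaller weight is a hypothesis here because the computation
  serves twice: inside the induction that establishes that formula, where \<open>h\<close> is \<open>U N k\<close>, and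
  afterwards for arbitrary \<open>h\<close>.\<close>

lemma dual_product_terminal_weight_step:
  assumes IH: "\<And>A' B' k. weight A' + weight B' < weight A + a + (weight B + b) \<Longrightarrow> k \<in> bdd_borel \<Longrightarrow>
      dual_product (\<lambda>J. word_op J k 0) A' B' = act2 (word_op A') (word_op B') (\<lambda>s t. k (s + t)) 0 0"
    and ab: "0 < a" "0 < b" and h: "h \<in> bdd_borel"
  shows "dual_product (terminal_weight z h) (A + letter a) (B + letter b) =
    act2 (word_op A \<circ> step ^^ (a - 1)) (word_op B \<circ> step ^^ (b - 1)) (merge_defect h) 0 0"
proof -
  define A1 where "A1 = word_op A \<circ> step ^^ (a - 1)"
  define B1 where "B1 = word_op B \<circ> step ^^ (b - 1)"
  define H where "H s t = h (s + t)" for s t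
  have H: "H \<in> bdd_borel2" unfolding H_def by (rule bdd_borel2_sum_arg[OF h])
  note walk_ops = word_op_in_ops walk_ops_funpow walk_ops_comp walk_ops_id walk_ops_step walk_ops_neg_restrict
  have A1: "A1 \<in> walk_ops" and B1: "B1 \<in> walk_ops"
    by (simp_all add: A1_def B1_def walk_ops)
  have pow: "act2 (step ^^ i) (step ^^ j) H = (\<lambda>s t. (step ^^ (i + j)) h (s + t))" for i j
    using act2_funpow_step[of i j h] by (simp add: H_def[abs_def])
  have "dual_product (\<lambda>J. terminal_weight z h (J + letter a)) A (B + letter b) =
      act2 (word_op A) (word_op (B + letter b)) (\<lambda>s t. (step ^^ (a - 1)) h (s + t)) 0 0"
    using ab by (simp add: terminal_weight_snoc IH h funpow_step_in_bdd_borel)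
  also have "(\<lambda>s t. (step ^^ (a - 1)) h (s + t)) = act2 (step ^^ (a - 1)) id H"
    using pow[of "a - 1" 0] by simp
  also have "act2 (word_op A) (word_op (B + letter b)) \<dots> = act2 A1 B1 (act2 id (step \<circ> neg_restrict) H)"
    using ab by (simp add: act2_act2 walk_ops A1 B1 H)
      (simp add: word_op_snoc A1_def B1_def funpow_step_Suc comp_assoc)
  finally have 1: "dual_product (\<lambda>J. terminal_weight z h (J + letter a)) A (B + letter b) =
    act2 A1 B1 (act2 id (step \<circ> neg_restrict) H) 0 0" .
  have "dual_product (\<lambda>J. terminal_weight z h (J + letter b)) (A + letter a) B =
      act2 (word_op (A + letter a)) (word_op B) (\<lambda>s t. (step ^^ (b - 1)) h (s + t)) 0 0"
    using ab by (simp add: terminal_weight_snoc IH h funpow_step_in_bdd_borel)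
  also have "(\<lambda>s t. (step ^^ (b - 1)) h (s + t)) = act2 id (step ^^ (b - 1)) H"
    using pow[of 0 "b - 1"] by simp
  also have "act2 (word_op (A + letter a)) (word_op B) \<dots> = act2 A1 B1 (act2 (step \<circ> neg_restrict) id H)"
    using ab by (simp add: act2_act2 walk_ops A1 B1 H)
      (simp add: word_op_snoc A1_def B1_def funpow_step_Suc comp_assoc)
  finally have 2: "dual_product (\<lambda>J. terminal_weight z h (J + letter b)) (A + letter a) B =
    act2 A1 B1 (act2 (step \<circ> neg_restrict) id H) 0 0" .
  have "dual_product (\<lambda>J. terminal_weight z h (J + letter (a + b))) A B =
      act2 (word_op A) (word_op B) (\<lambda>s t. (step ^^ (a + b - 1)) h (s + t)) 0 0"
    using ab by (simp add: terminal_weight_snoc IH h funpow_step_in_bdd_borel)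
  also have "(\<lambda>s t. (step ^^ (a + b - 1)) h (s + t)) = act2 (step ^^ a) (step ^^ (b - 1)) H"
    using pow[of a "b - 1"] ab by simp
  also have "act2 (word_op A) (word_op B) \<dots> = act2 A1 B1 (act2 step id H)"
    using ab by (simp add: act2_act2 walk_ops A1 B1 H)
      (simp add: A1_def B1_def funpow_step_Suc comp_assoc)
  finally have 3: "dual_product (\<lambda>J. terminal_weight z h (J + letter (a + b))) A B =
    act2 A1 B1 (act2 step id H) 0 0" .
  have "merge_defect h = (\<lambda>s t. act2 id (step \<circ> neg_restrict) H s t +
      act2 (step \<circ> neg_restrict) id H s t + act2 step id H s t)"
    by (simp add: merge_defect_act2 H_def[abs_def] fun_eq_iff)
  then show ?thesis
    unfolding dual_product_snoc_snoc[OF ab] 1 2 3 A1_def[symmetric] B1_def[symmetric]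
    by (simp add: act2_add A1 B1 bdd_borel2_add act2_bdd_borel2 walk_ops H)
qed

lemma merge_defect_step:
  assumes k: "k \<in> bdd_borel"
  shows "merge_defect (step k) = act2 step step (\<lambda>s t.
    neg_restrict (\<lambda>t. k (s + t)) t + neg_restrict (\<lambda>s. k (s + t)) s + k (s + t))"
proof (intro ext)
  fix s t
  define H where "H s t = k (s + t)" for s t
  have H: "H \<in> bdd_borel2" unfolding H_def by (rule bdd_borel2_sum_arg[OF k])
  note walk_ops = walk_ops_comp walk_ops_id walk_ops_step walk_ops_neg_restrict
  have s1: "(\<lambda>s t. step k (s + t)) = act2 step id H" and s2: "(\<lambda>s t. step k (s + t)) = act2 id step H"
    using act2_funpow_step[of 1 0 k] act2_funpow_step[of 0 1 k] by (simp_all add: H_def[abs_def])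
  have "merge_defect (step k) s t = act2 id (step \<circ> neg_restrict) (act2 step id H) s t +
      act2 (step \<circ> neg_restrict) id (act2 id step H) s t + act2 step id (act2 id step H) s t"
    using s1 s2 by (simp add: merge_defect_act2)
  also have "\<dots> = act2 step step (act2 id neg_restrict H) s t +
      act2 step step (act2 neg_restrict id H) s t + act2 step step H s t"
    by (simp add: act2_act2 walk_ops H)
  also have "\<dots> = act2 step step (\<lambda>s t. act2 id neg_restrict H s t + act2 neg_restrict id H s t + H s t) s t"
    by (simp add: act2_add walk_ops bdd_borel2_add act2_bdd_borel2 H)
  finally show "merge_defect (step k) s t = act2 step step (\<lambda>s t.
      neg_restrict (\<lambda>t. k (s + t)) t + neg_restrict (\<lambda>s. k (s + t)) s + k (s + t)) s t"
    by (simp add: act2_def H_def[abs_def])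
qed

text \<open>This is the Rota-Baxter identity \<open>(N\<^sub>1 + N\<^sub>2 + 1) N = N\<^sub>1 N\<^sub>2\<close> on functions of \<open>s + t\<close>: if the sum
  is negative, the first factor is \<open>-1\<close> for two negative positions and 0 for one, and if both
  positions are negative then so is the sum.\<close>

lemma merge_defect_step_neg_restrict:
  assumes k: "k \<in> bdd_borel"
  shows "merge_defect (step (neg_restrict k)) =
    act2 (step \<circ> neg_restrict) (step \<circ> neg_restrict) (\<lambda>s t. k (s + t))"
proof -
  have "(\<lambda>s t. neg_restrict (\<lambda>t. neg_restrict k (s + t)) t + neg_restrict (\<lambda>s. neg_restrict k (s + t)) s + neg_restrict k (s + t)) =
      act2 neg_restrict neg_restrict (\<lambda>s t. k (s + t))"
    by (auto simp: fun_eq_iff neg_restrict_def act2_def)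
  then show ?thesis
    unfolding merge_defect_step[OF neg_restrict_in_bdd_borel[OF k]]
    by (simp add: act2_act2 walk_ops_step walk_ops_neg_restrict bdd_borel2_sum_arg k)
qed

lemma word_op_eq_terminal_weight: "J \<noteq> 0 \<Longrightarrow> word_op J k 0 = terminal_weight z (step (neg_restrict k)) J"
  by (cases J rule: composition_snoc_cases) (simp_all add: word_op_snoc terminal_weight_snoc funpow_step_Suc)

text \<open>Two walks run side by side, and a function of the sum of their final positions is averaged. By the
  Rota-Baxter identity the constraints on the separate walks turn into constraints on one walk that
  interleaves the parts of both, summed over all quasi-shuffles.\<close>

lemma dual_product_word_op:
  "k \<in> bdd_borel \<Longrightarrow> dual_product (\<lambda>J. word_op J k 0) A B = act2 (word_op A) (word_op B) (\<lambda>s t. k (s + t)) 0 0"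
proof (induction "weight A + weight B" arbitrary: A B k rule: less_induct)
  case less
  show ?case
  proof (cases A rule: composition_snoc_cases)
    case 1
    then show ?thesis by (simp add: dual_product_left_0 act2_def)
  next
    case A: (2 A' a)
    show ?thesis
    proof (cases B rule: composition_snoc_cases)
      case 1
      then show ?thesis by (simp add: dual_product_right_0 act2_def)
    next
      case B: (2 B' b)
      let ?h = "step (neg_restrict k)"
      have "dual_product (\<lambda>J. word_op J k 0) A B = dual_product (terminal_weight 0 ?h) A B"
        unfolding dual_product_def
      proof (intro sum.cong refl)
        fix J assume "J \<in> {J. weight J = weight A + weight B}"
        then have "J \<noteq> 0" using A by auto
        then show "coproduct_coeff J A B * word_op J k 0 = coproduct_coeff J A B * terminal_weight 0 ?h J"
          by (simp add: word_op_eq_terminal_weight)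
      qed
      also have "\<dots> = act2 (word_op A' \<circ> step ^^ (a - 1)) (word_op B' \<circ> step ^^ (b - 1))
          (merge_defect ?h) 0 0"
        unfolding A(2) B(2)
        by (rule dual_product_terminal_weight_step)
          (use less A B in \<open>auto intro: neg_restrict_in_bdd_borel step_in_bdd_borel\<close>)
      also have "\<dots> = act2 (word_op A) (word_op B) (\<lambda>s t. k (s + t)) 0 0"
        using less.prems
        by (simp add: merge_defect_step_neg_restrict act2_act2 word_op_in_ops walk_ops_funpow walk_ops_comp walk_ops_step
            walk_ops_neg_restrict bdd_borel2_sum_arg)
          (use A B in \<open>simp add: word_op_snoc funpow_step_Suc comp_assoc\<close>)
      finally show ?thesis .
    qed
  qed
qed

lemma dual_product_terminal_weight:
  assumes "h \<in> bdd_borel" "0 < a" "0 < b"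
  shows "dual_product (terminal_weight z h) (A + letter a) (B + letter b) =
    act2 (word_op A \<circ> step ^^ (a - 1)) (word_op B \<circ> step ^^ (b - 1)) (merge_defect h) 0 0"
  using assms by (intro dual_product_terminal_weight_step dual_product_word_op)

text \<open>If the defect factors, the two walks decouple completely.\<close>

lemma dual_product_terminal_weight_mult:
  assumes h: "h \<in> bdd_borel" and defect: "merge_defect h = (\<lambda>s t. h s * h t)"
  shows "dual_product (terminal_weight 1 h) A B = terminal_weight 1 h A * terminal_weight 1 h B"
proof (cases A rule: composition_snoc_cases)
  case 1
  then show ?thesis by (simp add: dual_product_left_0)
next
  case A: (2 A' a)
  show ?thesis
  proof (cases B rule: composition_snoc_cases)
    case 1
    then show ?thesis by (simp add: dual_product_right_0)
  next
    case B: (2 B' b)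
    show ?thesis
      using A B by (simp add: dual_product_terminal_weight h defect act2_mult terminal_weight_snoc
          walk_ops_comp walk_ops_funpow walk_ops_step word_op_in_ops)
  qed
qed

lemma dual_product_terminal_weight_zero:
  assumes h: "h \<in> bdd_borel" and defect: "merge_defect h = (\<lambda>s t. 0)" and "A \<noteq> 0" "B \<noteq> 0"
  shows "dual_product (terminal_weight z h) A B = 0"
proof -
  obtain A' a where A: "A = A' + letter a" "0 < a"
    using assms by (cases A rule: composition_snoc_cases) auto
  obtain B' b where B: "B = B' + letter b" "0 < b"
    using assms by (cases B rule: composition_snoc_cases) auto
  have "act2 X Y (\<lambda>s t. 0) 0 0 = 0" if "X \<in> walk_ops" "Y \<in> walk_ops" for X Y
    using walk_ops_scale[OF that(1), of "\<lambda>_. 0" 0] walk_ops_scale[OF that(2), of "\<lambda>_. 0" 0]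
    by (simp add: act2_def fun_eq_iff)
  then show ?thesis
    using A B by (simp add: dual_product_terminal_weight h defect walk_ops_comp walk_ops_funpow walk_ops_step word_op_in_ops)
qed

end

section \<open>Null sets of product measures\<close>

lemma borel_measurable_completion_AE:
  fixes F G :: "'a \<Rightarrow> real"
  assumes G: "G \<in> borel_measurable M" and eq: "AE x in M. F x = G x"
  shows "F \<in> borel_measurable (completion M)"
proof (rule measurableI)
  fix S :: "real set" assume S: "S \<in> sets borel"
  have [measurable]: "G \<in> borel_measurable (completion M)"
    using G by (rule measurable_completion)
  have [measurable]: "Measurable.pred (completion M) (\<lambda>x. F x \<noteq> G x)"
    using eq by (intro sets_completion_AE) simp
  have [measurable]: "Measurable.pred (completion M) (\<lambda>x. F x \<noteq> G x \<and> F x \<in> S)"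
    using eq by (intro sets_completion_AE) auto
  have "Measurable.pred (completion M) (\<lambda>x. (\<not> F x \<noteq> G x \<and> G x \<in> S) \<or> (F x \<noteq> G x \<and> F x \<in> S))"
    using S by measurable
  also have "(\<lambda>x. (\<not> F x \<noteq> G x \<and> G x \<in> S) \<or> (F x \<noteq> G x \<and> F x \<in> S)) = (\<lambda>x. F x \<in> S)"
    by auto
  finally show "F -` S \<inter> space (completion M) \<in> sets (completion M)"
    by (simp add: pred_def vimage_def Int_def conj_commute)
qed simp

lemma integral_completion_cong_AE:
  fixes F G :: "'a \<Rightarrow> real"
  assumes G: "G \<in> borel_measurable M" and eq: "AE x in M. F x = G x"
  shows "integral\<^sup>L (completion M) F = integral\<^sup>L M G"
proof -
  have "integral\<^sup>L (completion M) F = integral\<^sup>L (completion M) G"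
    using borel_measurable_completion_AE[OF assms] measurable_completion[OF G] AE_completion[OF eq]
    by (rule integral_cong_AE)
  then show ?thesis using integral_completion[OF G] by simp
qed

interpretation lborel_product: product_sigma_finite "\<lambda>_ :: nat. lborel :: real measure"
  by standard

text \<open>By Fubini's theorem it suffices that \<open>\<phi>\<close> avoids null sets as a function of a single coordinate.\<close>

lemma AE_PiM_lborel_insert:
  fixes \<phi> :: "(nat \<Rightarrow> real) \<Rightarrow> real"
  assumes I: "finite I" "i \<notin> I" and \<phi>[measurable]: "\<phi> \<in> borel_measurable (Pi\<^sub>M (insert i I) (\<lambda>_. lborel))"
    and P: "AE y in lborel. P y"
    and null: "\<And>N x. N \<in> null_sets lborel \<Longrightarrow> AE y in lborel. \<phi> (x(i := y)) \<notin> N"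
  shows "AE x in Pi\<^sub>M (insert i I) (\<lambda>_. lborel). P (\<phi> x)"
proof -
  let ?M = "Pi\<^sub>M (insert i I) (\<lambda>_. lborel) :: (nat \<Rightarrow> real) measure"
  obtain N where N: "N \<in> null_sets lborel" "{y. \<not> P y} \<subseteq> N"
    using P by (auto simp: eventually_ae_filter)
  have [measurable]: "N \<in> sets borel" using N by auto
  have "(\<integral>\<^sup>+x. indicator N (\<phi> x) \<partial>?M) =
      (\<integral>\<^sup>+x. \<integral>\<^sup>+y. indicator N (\<phi> (x(i := y))) \<partial>lborel \<partial>Pi\<^sub>M I (\<lambda>_. lborel))"
    by (rule lborel_product.product_nn_integral_insert[OF I]) simp
  also have "\<dots> = 0"
  proof -
    have "(\<integral>\<^sup>+y. indicator N (\<phi> (x(i := y))) \<partial>lborel) = (\<integral>\<^sup>+(y::real). 0 \<partial>lborel)" for x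
      by (rule nn_integral_cong_AE) (use null[OF N(1), of x] in eventually_elim, simp)
    then show ?thesis by simp
  qed
  finally have "AE x in ?M. indicator N (\<phi> x) = (0 :: ennreal)"
    by (subst (asm) nn_integral_0_iff_AE) simp_all
  then show ?thesis
    by eventually_elim (use N in \<open>auto simp: indicator_def split: if_splits\<close>)
qed

lemma AE_PiM_lborel_component:
  fixes P :: "real \<Rightarrow> bool" and n :: nat
  assumes P: "AE y in lborel. P y" and i: "i < n"
  shows "AE x in Pi\<^sub>M {..<n} (\<lambda>_. lborel). P (x i)"
proof -
  have "AE x in Pi\<^sub>M (insert i ({..<n} - {i})) (\<lambda>_. lborel). P (x i)"
    by (rule AE_PiM_lborel_insert[OF _ _ _ P]) (auto intro: AE_not_in)
  moreover have "insert i ({..<n} - {i}) = {..<n}" using i by auto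
  ultimately show ?thesis by (simp only:)
qed

lemma AE_PiM_lborel_neg_sum:
  fixes P :: "real \<Rightarrow> bool" and n :: nat
  assumes P: "AE y in lborel. P y" and n: "0 < n"
  shows "AE x in Pi\<^sub>M {..<n} (\<lambda>_. lborel). P (- (\<Sum>i<n. x i))"
proof -
  obtain m where m: "n = Suc m" using n by (cases n) auto
  have eq: "{..<n} = insert m {..<m}" using m by auto
  have "AE x in Pi\<^sub>M (insert m {..<m}) (\<lambda>_. lborel). P (- (\<Sum>i\<in>insert m {..<m}. x i))"
  proof (rule AE_PiM_lborel_insert[OF _ _ _ P])
    fix N :: "real set" and x :: "nat \<Rightarrow> real" assume N: "N \<in> null_sets lborel"
    have [measurable]: "N \<in> sets borel" using N by auto
    have "AE y in lborel. - (\<Sum>i<m. x i) + (-1) * y \<notin> N"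
      by (rule AE_borel_affine) (use AE_not_in[OF N] in auto)
    then show "AE y in lborel. - (\<Sum>i\<in>insert m {..<m}. (x(m := y)) i) \<notin> N"
      by (simp add: algebra_simps)
  qed auto
  then show ?thesis by (simp only: eq)
qed

section \<open>Weights as operator words\<close>

lemma sigma_borel [measurable]: "sigma s \<in> borel_measurable borel"
  by (cases s) simp_all

lemma sigma_bdd_borel: "sigma s \<in> bdd_borel"
  using sigma_borel[of s] by (cases s) (auto simp: bdd_borel_def indicator_def intro!: exI[of _ 1])

context bounded_density begin

text \<open>Here every step is followed by a constraint, as in the weights of sign sequences, whereas
  \<open>word_op\<close> constrains only the ends of the parts.\<close>

definition sign_op :: "sign list \<Rightarrow> (real \<Rightarrow> real) \<Rightarrow> real \<Rightarrow> real" where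
  "sign_op \<epsilon> h = foldr (\<lambda>s k. step (\<lambda>x. sigma s x * k x)) \<epsilon> h"

lemma sign_op_Nil [simp]: "sign_op [] h = h"
  by (simp add: sign_op_def)

lemma sign_op_snoc: "sign_op (\<epsilon> @ [s]) h = sign_op \<epsilon> (step (\<lambda>x. sigma s x * h x))"
  by (simp add: sign_op_def)

lemma step_uminus: "step (\<lambda>x. - h x) = (\<lambda>x. - step h x)"
  by (simp add: step_def fun_eq_iff)

lemma sign_op_uminus: "sign_op \<epsilon> (\<lambda>x. - h x) = (\<lambda>x. - sign_op \<epsilon> h x)"
  by (induction \<epsilon> arbitrary: h rule: rev_induct) (simp_all add: sign_op_snoc step_uminus)

lemma terminal_weight_add:
  assumes "h \<in> bdd_borel" "k \<in> bdd_borel" "J \<noteq> 0"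
  shows "terminal_weight z (\<lambda>x. h x + k x) J = terminal_weight z h J + terminal_weight z k J"
proof (cases J rule: composition_snoc_cases)
  case (2 I j)
  have "(word_op I \<circ> step ^^ (j - 1)) (\<lambda>x. h x + k x) =
      (\<lambda>x. (word_op I \<circ> step ^^ (j - 1)) h x + (word_op I \<circ> step ^^ (j - 1)) k x)"
    using assms by (intro walk_ops_add walk_ops_comp word_op_in_ops walk_ops_funpow walk_ops_step)
  then show ?thesis using 2 by (simp add: terminal_weight_snoc fun_eq_iff)
qed (use assms in simp)

lemma terminal_weight_uminus:
  assumes "h \<in> bdd_borel" "J \<noteq> 0"
  shows "terminal_weight z (\<lambda>x. - h x) J = - terminal_weight z h J"
proof (cases J rule: composition_snoc_cases)
  case (2 I j)
  have "(word_op I \<circ> step ^^ (j - 1)) (\<lambda>x. (-1) * h x) =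
      (\<lambda>x. (-1) * (word_op I \<circ> step ^^ (j - 1)) h x)"
    using assms by (intro walk_ops_scale walk_ops_comp word_op_in_ops walk_ops_funpow walk_ops_step)
  then show ?thesis using 2 by (simp add: terminal_weight_snoc fun_eq_iff)
qed (use assms in simp)

lemma terminal_weight_signed_composition_snoc:
  "terminal_weight z h (signed_composition (\<delta> @ [Plus])) = terminal_weight z (step h) (signed_composition \<delta>)"
  "terminal_weight z h (signed_composition (\<delta> @ [Minus])) = terminal_weight z (step (neg_restrict h)) (signed_composition \<delta>)"
proof -
  obtain J n where J: "signed_composition \<delta> = J + letter n" "0 < n"
    by (cases "signed_composition \<delta>" rule: composition_snoc_cases) auto
  have "step ^^ n = step ^^ (n - 1) \<circ> step"
    using J(2) by (rule funpow_step_Suc)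
  then have pow: "(step ^^ n) k = (step ^^ (n - 1)) (step k)" for k
    by (simp only: o_apply)
  have "terminal_weight z h (J + letter (Suc n)) = terminal_weight z (step h) (J + letter n)"
    using J(2) by (simp add: terminal_weight_snoc pow del: funpow.simps)
  then show "terminal_weight z h (signed_composition (\<delta> @ [Plus])) = terminal_weight z (step h) (signed_composition \<delta>)"
    by (simp only: signed_composition_snoc_Plus[OF J] J(1))
  show "terminal_weight z h (signed_composition (\<delta> @ [Minus])) =
      terminal_weight z (step (neg_restrict h)) (signed_composition \<delta>)"
    using J(2) unfolding signed_composition_snoc_Minus terminal_weight_snoc[OF zero_less_one] J(1)
    by (simp add: terminal_weight_snoc word_op_snoc pow)
qed

text \<open>A position with sign plus may be refined or not, and the two possibilities add up to \<open>1 + N\<close>, the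
  restriction to nonnegative positions. A position with sign minus must stay, and \<open>N\<close> is minus the
  restriction to negative positions.\<close>

lemma sum_finer_terminal_weight:
  assumes "h \<in> bdd_borel"
  shows "(\<Sum>\<delta>\<in>finer_signs \<epsilon>. terminal_weight z h (signed_composition \<delta>)) =
    (-1) ^ count_list \<epsilon> Minus * sign_op \<epsilon> h 0"
  using assms
proof (induction \<epsilon> arbitrary: h rule: rev_induct)
  case Nil
  show ?case
    using terminal_weight_snoc[of 1 z h 0] by (simp add: signed_composition_Nil)
next
  case (snoc s \<epsilon>)
  have neg: "neg_restrict h = (\<lambda>x. - (sigma Minus x * h x))"
    by (auto simp: neg_restrict_def fun_eq_iff)
  have P: "step (\<lambda>x. sigma s x * h x) \<in> bdd_borel" for s
    by (intro step_in_bdd_borel bdd_borel_mult sigma_bdd_borel snoc.prems)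
  show ?case
  proof (cases s)
    case Plus
    have "step (\<lambda>x. sigma Plus x * h x) = step (\<lambda>x. h x + neg_restrict h x)"
      by (intro arg_cong[of _ _ step]) (auto simp: neg_restrict_def fun_eq_iff)
    also have "\<dots> = (\<lambda>x. step h x + step (neg_restrict h) x)"
      by (intro walk_ops_add walk_ops_step snoc.prems neg_restrict_in_bdd_borel)
    finally have "terminal_weight z (step h) J + terminal_weight z (step (neg_restrict h)) J =
        terminal_weight z (step (\<lambda>x. sigma Plus x * h x)) J" if "J \<noteq> 0" for J
      using that snoc.prems by (simp add: terminal_weight_add step_in_bdd_borel neg_restrict_in_bdd_borel)
    then show ?thesis
      using snoc.IH[OF P[of Plus]]
      by (simp only: Plus sum_finer_signs_snoc_Plus terminal_weight_signed_composition_snoc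
          signed_composition_neq_0 not_False_eq_True sign_op_snoc) simp
  next
    case Minus
    have "terminal_weight z (step (neg_restrict h)) J = - terminal_weight z (step (\<lambda>x. sigma Minus x * h x)) J"
      if "J \<noteq> 0" for J
      unfolding neg step_uminus by (rule terminal_weight_uminus[OF P that])
    then show ?thesis
      using snoc.IH[OF P[of Minus]]
      by (simp only: Minus sum_finer_signs_snoc_Minus terminal_weight_signed_composition_snoc
          signed_composition_neq_0 not_False_eq_True sign_op_snoc sum_negf) simp
  qed
qed

lemma ribbon_series_sign_op:
  assumes h: "h \<in> bdd_borel" and c: "\<And>\<epsilon>. c \<epsilon> = sign_op \<epsilon> h 0"
  shows "series_one n + ribbon_series c n = S_series (terminal_weight 1 h) n"
proof (cases "n = 0")
  case True
  have "{J. weight J = 0} = {0}" by auto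
  then show ?thesis using True by (simp add: ribbon_series_def series_one_def S_series_def S_word_def)
next
  case False
  have "c \<epsilon> = (-1) ^ count_list \<epsilon> Minus *
      (\<Sum>\<delta>\<in>finer_signs \<epsilon>. terminal_weight 1 h (signed_composition \<delta>))" for \<epsilon>
    by (simp add: sum_finer_terminal_weight[OF h] c flip: power_add mult_2 power_mult)
  from ribbon_series_eq_S_series[OF this] show ?thesis
    using False by (simp add: series_one_def)
qed

lemma sign_walk_measurable [measurable]:
  "(\<lambda>x. (\<Prod>i<n. g (x i)) * (\<Prod>i<n. sigma (\<epsilon> ! i) (\<Sum>j\<le>i. x j))) \<in>
    borel_measurable (Pi\<^sub>M {..<n} (\<lambda>_. lborel))"
proof -
  have "(\<lambda>x. \<Sum>j\<le>i. x j) \<in> borel_measurable (Pi\<^sub>M {..<n} (\<lambda>_. lborel :: real measure))" if "i < n" for i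
    using that by (intro borel_measurable_sum measurable_component_singleton) auto
  then have "(\<lambda>x. sigma (\<epsilon> ! i) (\<Sum>j\<le>i. x j)) \<in> borel_measurable (Pi\<^sub>M {..<n} (\<lambda>_. lborel :: real measure))"
    if "i < n" for i
    using that by (intro measurable_compose[OF _ sigma_borel]) auto
  then show ?thesis
    by (intro borel_measurable_times borel_measurable_prod) auto
qed

text \<open>Integrating out the last variable replaces the test function \<open>h\<close> of the endpoint by a test
  function of the previous position.\<close>

lemma integral_sign_walk:
  assumes "h \<in> bdd_borel"
  shows "(\<integral>x. (\<Prod>i<length \<epsilon>. g (x i)) * (\<Prod>i<length \<epsilon>. sigma (\<epsilon> ! i) (\<Sum>j\<le>i. x j)) *
      h (\<Sum>i<length \<epsilon>. x i) \<partial>Pi\<^sub>M {..<length \<epsilon>} (\<lambda>_. lborel)) = sign_op \<epsilon> h 0"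
  using assms
proof (induction \<epsilon> arbitrary: h rule: rev_induct)
  case Nil
  show ?case by (simp add: PiM_empty lebesgue_integral_count_space_finite)
next
  case (snoc s \<epsilon>)
  define n where "n = length \<epsilon>"
  define W where "W x = (\<Prod>i<n. g (x i)) * (\<Prod>i<n. sigma (\<epsilon> ! i) (\<Sum>j\<le>i. x j))" for x
  define F where "F x = (\<Prod>i<Suc n. g (x i)) * (\<Prod>i<Suc n. sigma ((\<epsilon> @ [s]) ! i) (\<Sum>j\<le>i. x j)) *
      h (\<Sum>i<Suc n. x i)" for x
  have [measurable]: "h \<in> borel_measurable borel" using snoc.prems by (simp add: bdd_borel_def)
  obtain K where K: "\<And>x. \<bar>h x\<bar> \<le> K" using snoc.prems by (auto simp: bdd_borel_def)
  have eq: "{..<Suc n} = insert n {..<n}" by auto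
  have "integrable (Pi\<^sub>M {..<Suc n} (\<lambda>_. lborel)) F"
  proof (rule Bochner_Integration.integrable_bound)
    show "integrable (Pi\<^sub>M {..<Suc n} (\<lambda>_. lborel)) (\<lambda>x. K * (\<Prod>i<Suc n. g (x i)))"
      by (intro integrable_mult_right lborel_product.product_integrable_prod integrable_g) simp
    have "(\<lambda>x. h (\<Sum>i<Suc n. x i)) \<in> borel_measurable (Pi\<^sub>M {..<Suc n} (\<lambda>_. lborel :: real measure))"
      by (intro measurable_compose[OF borel_measurable_sum] measurable_component_singleton) auto
    then show "F \<in> borel_measurable (Pi\<^sub>M {..<Suc n} (\<lambda>_. lborel))"
      unfolding F_def[abs_def] by (intro borel_measurable_times[OF sign_walk_measurable])
    have sig: "0 \<le> sigma s x \<and> sigma s x \<le> 1" for s x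
      by (cases s) (auto simp: indicator_def)
    show "AE x in Pi\<^sub>M {..<Suc n} (\<lambda>_. lborel). norm (F x) \<le> norm (K * (\<Prod>i<Suc n. g (x i)))"
    proof (rule AE_I2)
      fix x :: "nat \<Rightarrow> real"
      define p where "p = (\<Prod>i<Suc n. sigma ((\<epsilon> @ [s]) ! i) (\<Sum>j\<le>i. x j))"
      have "0 \<le> p" "p \<le> 1"
        unfolding p_def by (intro prod_nonneg prod_le_1; use sig in blast)+
      then have "\<bar>p * h (\<Sum>i<Suc n. x i)\<bar> \<le> 1 * \<bar>K\<bar>"
        unfolding abs_mult using K[of "\<Sum>i<Suc n. x i"] by (intro mult_mono) auto
      then have "\<bar>\<Prod>i<Suc n. g (x i)\<bar> * \<bar>p * h (\<Sum>i<Suc n. x i)\<bar> \<le> \<bar>\<Prod>i<Suc n. g (x i)\<bar> * \<bar>K\<bar>"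
        by (intro mult_left_mono) auto
      moreover have "F x = (\<Prod>i<Suc n. g (x i)) * (p * h (\<Sum>i<Suc n. x i))"
        unfolding F_def p_def[symmetric] by (rule mult.assoc)
      ultimately show "norm (F x) \<le> norm (K * (\<Prod>i<Suc n. g (x i)))"
        unfolding real_norm_def by (simp only: abs_mult) (simp only: mult.commute)
    qed
  qed
  then have "integral\<^sup>L (Pi\<^sub>M {..<Suc n} (\<lambda>_. lborel)) F =
      (\<integral>x. \<integral>y. F (x(n := y)) \<partial>lborel \<partial>Pi\<^sub>M {..<n} (\<lambda>_. lborel))"
    unfolding eq by (intro lborel_product.product_integral_insert) auto
  also have "\<dots> = (\<integral>x. W x * step (\<lambda>u. sigma s u * h u) (\<Sum>i<n. x i) \<partial>Pi\<^sub>M {..<n} (\<lambda>_. lborel))"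
  proof (rule Bochner_Integration.integral_cong[OF refl])
    fix x
    have "(\<Prod>i<n. sigma ((\<epsilon> @ [s]) ! i) (\<Sum>j\<le>i. (x(n := y)) j)) =
        (\<Prod>i<n. sigma (\<epsilon> ! i) (\<Sum>j\<le>i. x j))" for y
      by (intro prod.cong refl) (auto simp: nth_append n_def intro!: arg_cong[of _ _ "sigma _"] sum.cong)
    moreover have "{..n} = insert n {..<n}" by auto
    ultimately have "F (x(n := y)) = W x * (g y * (sigma s ((\<Sum>i<n. x i) + y) * h ((\<Sum>i<n. x i) + y)))" for y
      by (simp add: F_def W_def n_def[symmetric] nth_append add.commute)
    then show "(\<integral>y. F (x(n := y)) \<partial>lborel) = W x * step (\<lambda>u. sigma s u * h u) (\<Sum>i<n. x i)"
      by (simp add: step_def)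
  qed
  also have "(\<integral>x. W x * step (\<lambda>u. sigma s u * h u) (\<Sum>i<n. x i) \<partial>Pi\<^sub>M {..<n} (\<lambda>_. lborel)) =
      sign_op \<epsilon> (step (\<lambda>u. sigma s u * h u)) 0"
    unfolding W_def n_def
    by (intro snoc.IH step_in_bdd_borel bdd_borel_mult sigma_bdd_borel snoc.prems)
  finally show ?case
    by (simp add: F_def[abs_def] sign_op_snoc flip: n_def)
qed

definition refl_density :: "real \<Rightarrow> real" where
  "refl_density s = g (- s)"

lemma refl_density_bdd_borel: "refl_density \<in> bdd_borel"
  using g_le by (auto simp: bdd_borel_def refl_density_def[abs_def])

text \<open>Formally this is \<open>(N\<^sub>1 + N\<^sub>2 + 1)\<close> applied to the Dirac mass at \<open>s + t = 0\<close>. On that line exactly one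
  of \<open>s\<close> and \<open>t\<close> is negative, except at the origin, so the three terms cancel almost everywhere.\<close>

lemma merge_defect_refl_density: "merge_defect refl_density = (\<lambda>s t. 0)"
proof (intro ext)
  fix s t
  have int: "integrable lborel (\<lambda>x. g x * k (t + x))" if "k \<in> bdd_borel" for k
    using that by (rule integrable_step)
  have b: "(\<lambda>t. refl_density (s + t)) \<in> bdd_borel"
    by (rule bdd_borel2_slice[OF bdd_borel2_sum_arg[OF refl_density_bdd_borel]])
  \<comment> \<open>The substitution exchanges the two walks: if the walk from \<open>t\<close> moves by \<open>z\<close> and the sum of the
    positions ends at 0, then the walk from \<open>s\<close> moves by \<open>-(s + t) - z\<close>.\<close>
  have "step (neg_restrict (\<lambda>s. refl_density (s + t))) s =
      (\<integral>z. g (- (s + t) + (-1) * z) * neg_restrict (\<lambda>s. refl_density (s + t)) (s + (- (s + t) + (-1) * z)) \<partial>lborel)"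
    unfolding step_def by (subst lborel_integral_real_affine[of "-1" _ "- (s + t)"]) simp_all
  also have "\<dots> = (\<integral>z. - (g z * (if 0 < t + z then refl_density (s + (t + z)) else 0)) \<partial>lborel)"
    by (intro Bochner_Integration.integral_cong refl)
      (simp add: neg_restrict_def refl_density_def algebra_simps)
  also have "\<dots> = (\<integral>z. - (g z * neg_restrict (\<lambda>t. refl_density (s + t)) (t + z)) - g z * refl_density (s + (t + z)) \<partial>lborel)"
  proof (rule integral_cong_AE)
    \<comment> \<open>The origin, where both positions are 0, is a single value of \<open>z\<close>.\<close>
    have "AE z in lborel. z \<noteq> - t"
      by (rule AE_lborel_singleton)
    then show "AE z in lborel. - (g z * (if 0 < t + z then refl_density (s + (t + z)) else 0)) =
        - (g z * neg_restrict (\<lambda>t. refl_density (s + t)) (t + z)) - g z * refl_density (s + (t + z))"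
      by eventually_elim (auto simp: neg_restrict_def)
  qed (use borel_g in \<open>unfold neg_restrict_def refl_density_def, measurable\<close>)
  also have "\<dots> = - step (neg_restrict (\<lambda>t. refl_density (s + t))) t - step refl_density (s + t)"
    using int[OF neg_restrict_in_bdd_borel[OF b]] int[OF b]
    by (simp add: step_def add.assoc)
  finally show "merge_defect refl_density s t = 0"
    by (simp add: merge_defect_def)
qed

lemma m_weight_eq_sign_op:
  assumes f: "AE x in lborel. f x = g x"
  shows "m_weight f \<epsilon> = sign_op \<epsilon> (\<lambda>_. 1) 0"
proof -
  define n where "n = length \<epsilon>"
  have "AE x in Pi\<^sub>M {..<n} (\<lambda>_. lborel). \<forall>i\<in>{..<n}. f (x i) = g (x i)"
    by (intro AE_finite_allI) (auto intro: AE_PiM_lborel_component[OF f])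
  then have "AE x in Pi\<^sub>M {..<n} (\<lambda>_. lborel).
      (\<Prod>i<n. f (x i)) * (\<Prod>i<n. sigma (\<epsilon> ! i) (\<Sum>j\<le>i. x j)) =
      (\<Prod>i<n. g (x i)) * (\<Prod>i<n. sigma (\<epsilon> ! i) (\<Sum>j\<le>i. x j))"
    by eventually_elim simp
  then have "m_weight f \<epsilon> = (\<integral>x. (\<Prod>i<n. g (x i)) * (\<Prod>i<n. sigma (\<epsilon> ! i) (\<Sum>j\<le>i. x j))
      \<partial>Pi\<^sub>M {..<n} (\<lambda>_. lborel))"
    unfolding m_weight_def lebesgue_n_def n_def[symmetric]
    by (intro integral_completion_cong_AE sign_walk_measurable)
  also have "\<dots> = sign_op \<epsilon> (\<lambda>_. 1) 0"
    using integral_sign_walk[of "\<lambda>_. 1" \<epsilon>] by (simp add: n_def)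
  finally show ?thesis .
qed

lemma d_weight_eq_sign_op:
  assumes f: "AE x in lborel. f x = g x"
  shows "d_weight c f (\<epsilon> @ [Plus]) = (if \<epsilon> = [] then c else sign_op \<epsilon> refl_density 0)"
proof (cases "\<epsilon> = []")
  case True
  then show ?thesis by (simp add: d_weight_def)
next
  case False
  define n where "n = length \<epsilon>"
  have n: "0 < n" using False by (simp add: n_def)
  define W where "W x = (\<Prod>i<n. g (x i)) * (\<Prod>i<n. sigma (\<epsilon> ! i) (\<Sum>j\<le>i. x j)) *
      refl_density (\<Sum>i<n. x i)" for x
  have "AE x in Pi\<^sub>M {..<n} (\<lambda>_. lborel). \<forall>i\<in>{..<n}. f (x i) = g (x i)"
    by (intro AE_finite_allI) (auto intro: AE_PiM_lborel_component[OF f])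
  moreover have "AE x in Pi\<^sub>M {..<n} (\<lambda>_. lborel). f (- (\<Sum>i<n. x i)) = g (- (\<Sum>i<n. x i))"
    by (rule AE_PiM_lborel_neg_sum[OF f n])
  ultimately have AE: "AE x in Pi\<^sub>M {..<n} (\<lambda>_. lborel). (\<Prod>i<n. f (x i)) * f (- (\<Sum>i<n. x i)) *
      (\<Prod>i<n. sigma ((\<epsilon> @ [Plus]) ! i) (\<Sum>j\<le>i. x j)) = W x"
    by eventually_elim (simp add: W_def refl_density_def nth_append n_def)
  have "(\<lambda>x. refl_density (\<Sum>i<n. x i)) \<in> borel_measurable (Pi\<^sub>M {..<n} (\<lambda>_. lborel :: real measure))"
    using refl_density_bdd_borel unfolding bdd_borel_def
    by (intro measurable_compose[OF borel_measurable_sum] measurable_component_singleton) auto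
  then have "W \<in> borel_measurable (Pi\<^sub>M {..<n} (\<lambda>_. lborel))"
    unfolding W_def[abs_def] by (intro borel_measurable_times[OF sign_walk_measurable])
  then have "(\<integral>x. (\<Prod>i<n. f (x i)) * f (- (\<Sum>i<n. x i)) *
      (\<Prod>i<n. sigma ((\<epsilon> @ [Plus]) ! i) (\<Sum>j\<le>i. x j)) \<partial>lebesgue_n n) =
      integral\<^sup>L (Pi\<^sub>M {..<n} (\<lambda>_. lborel)) W"
    unfolding lebesgue_n_def using AE by (rule integral_completion_cong_AE)
  also have "\<dots> = sign_op \<epsilon> refl_density 0"
    using integral_sign_walk[OF refl_density_bdd_borel, of \<epsilon>] by (simp only: W_def[abs_def] n_def)
  finally show ?thesis
    using False by (simp add: d_weight_def n_def)
qed

section \<open>The three series\<close>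

text \<open>The walk must end on the nonnegative side, so \<open>k\<close> is the indicator of \<open>[0, \<infinity>)\<close> and
  \<open>(N\<^sub>1 + N\<^sub>2 + 1) k(s + t)\<close> is \<open>[s \<ge> 0][t \<ge> 0]\<close>: with both positions negative the indicator
  vanishes, and with exactly one negative the first factor does.\<close>

lemma grouplike_R_series:
  assumes f: "AE x in lborel. f x = g x"
  shows "grouplike (R_series f)"
proof -
  define h where "h = step (sigma Plus)"
  have h: "h \<in> bdd_borel" unfolding h_def by (intro step_in_bdd_borel sigma_bdd_borel)
  have "R_series f = S_series (terminal_weight 1 h)"
    unfolding R_series_def
    by (intro ext ribbon_series_sign_op[OF h]) (simp add: m_weight_eq_sign_op[OF f] sign_op_snoc h_def)
  moreover have "merge_defect h = (\<lambda>s t. h s * h t)"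
  proof -
    have "(\<lambda>s t. neg_restrict (\<lambda>t. sigma Plus (s + t)) t + neg_restrict (\<lambda>s. sigma Plus (s + t)) s + sigma Plus (s + t)) =
        (\<lambda>s t. sigma Plus s * sigma Plus t)"
      by (auto simp: fun_eq_iff neg_restrict_def indicator_def)
    then show ?thesis
      unfolding h_def merge_defect_step[OF sigma_bdd_borel]
      by (simp only: act2_mult walk_ops_step sigma_bdd_borel fun_eq_iff) simp
  qed
  ultimately show ?thesis
    using grouplike_S_series[of "terminal_weight 1 h"] dual_product_terminal_weight_mult[OF h] by simp
qed

text \<open>Here \<open>k\<close> is \<open>N 1\<close>, and the Rota-Baxter identity factors the defect.\<close>

lemma grouplike_L_series:
  assumes f: "AE x in lborel. f x = g x"
  shows "grouplike (L_series f)"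
proof -
  define h where "h = step (neg_restrict (\<lambda>_. 1))"
  have h: "h \<in> bdd_borel" unfolding h_def by (intro step_in_bdd_borel neg_restrict_in_bdd_borel) simp
  have h_eq: "h = (\<lambda>x. - step (\<lambda>x. sigma Minus x * 1) x)"
    unfolding h_def step_uminus[symmetric] by (intro arg_cong[of _ _ step]) (auto simp: neg_restrict_def)
  have "L_series f n = S_series (terminal_weight 1 h) n" for n
  proof -
    have "L_series f n = series_one n + ribbon_series (\<lambda>\<epsilon>. - m_weight f (\<epsilon> @ [Minus])) n"
      by (simp add: L_series_def ribbon_series_def sum_negf)
    also have "\<dots> = S_series (terminal_weight 1 h) n"
      by (rule ribbon_series_sign_op[OF h])
        (simp only: m_weight_eq_sign_op[OF f] sign_op_snoc h_eq sign_op_uminus)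
    finally show ?thesis .
  qed
  then have "L_series f = S_series (terminal_weight 1 h)" by (rule ext)
  moreover have "merge_defect h = (\<lambda>s t. h s * h t)"
  proof (intro ext)
    fix s t
    have "merge_defect h s t = act2 (step \<circ> neg_restrict) (step \<circ> neg_restrict) (\<lambda>s t. 1 * 1) s t"
      unfolding h_def by (subst merge_defect_step_neg_restrict) simp_all
    also have "\<dots> = h s * h t"
      by (subst act2_mult) (simp_all add: walk_ops_comp walk_ops_step walk_ops_neg_restrict h_def)
    finally show "merge_defect h s t = h s * h t" .
  qed
  ultimately show ?thesis
    using grouplike_S_series[of "terminal_weight 1 h"] dual_product_terminal_weight_mult[OF h] by simp
qed

text \<open>The free number \<open>c\<close> is the coefficient of the single word of weight 1. A product of two nonempty
  compositions has weight at least 2, so that coefficient does not enter the condition for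
  primitivity.\<close>

lemma primitive_D_series:
  assumes f: "AE x in lborel. f x = g x"
  shows "primitive (D_series c f)"
proof -
  define w where "w J = (if J = letter 1 then c else terminal_weight 0 refl_density J)" for J
  have "(0 :: composition) \<noteq> letter 1"
    using add_letter_neq_0(2)[of 1 0] by simp
  then have w0: "w 0 = 0" by (simp add: w_def)
  have "D_series c f n = S_series w n" for n
  proof (cases "n = 0")
    case True
    have "{J. weight J = 0} = {0}" by auto
    then show ?thesis using True w0 by (simp add: D_series_def ribbon_series_def S_series_def)
  next
    case False
    have "d_weight c f (\<epsilon> @ [Plus]) =
        (-1) ^ count_list \<epsilon> Minus * (\<Sum>\<delta>\<in>finer_signs \<epsilon>. w (signed_composition \<delta>))" for \<epsilon>
    proof (cases "\<epsilon> = []")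
      case True
      then show ?thesis by (simp add: d_weight_def w_def signed_composition_Nil)
    next
      case False
      have "w (signed_composition \<delta>) = terminal_weight 0 refl_density (signed_composition \<delta>)"
        if "\<delta> \<in> finer_signs \<epsilon>" for \<delta>
      proof -
        have "length \<delta> = length \<epsilon>" using that by (auto simp: finer_signs_def dest: list_all2_lengthD)
        then have "weight (signed_composition \<delta>) \<noteq> weight (letter 1)"
          using False by (simp add: signed_composition(1))
        then show ?thesis by (auto simp: w_def)
      qed
      then have "(\<Sum>\<delta>\<in>finer_signs \<epsilon>. w (signed_composition \<delta>)) =
          (-1) ^ count_list \<epsilon> Minus * sign_op \<epsilon> refl_density 0"
        using sum_finer_terminal_weight[OF refl_density_bdd_borel, of 0 \<epsilon>] by simp
      then show ?thesis
        using False by (simp add: d_weight_eq_sign_op[OF f] flip: power_add mult_2 power_mult)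
    qed
    from ribbon_series_eq_S_series[OF this] show ?thesis
      using False by (simp add: D_series_def)
  qed
  then have "D_series c f = S_series w" by (rule ext)
  moreover have "dual_product w A B = 0" if "A \<noteq> 0" "B \<noteq> 0" for A B
  proof -
    have pos: "weight A \<noteq> 0" "weight B \<noteq> 0" using that by simp_all
    have "w J = terminal_weight 0 refl_density J" if "weight J = weight A + weight B" for J
    proof -
      have "weight J \<noteq> weight (letter 1)"
        unfolding that weight_letter using pos by linarith
      then show ?thesis by (auto simp: w_def)
    qed
    then have "dual_product w A B = dual_product (terminal_weight 0 refl_density) A B"
      unfolding dual_product_def by (intro sum.cong) auto
    then show ?thesis
      using dual_product_terminal_weight_zero[OF refl_density_bdd_borel merge_defect_refl_density that] by simp
  qed
  ultimately show ?thesis using primitive_S_series[of w] w0 by simp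
qed

end

text \<open>The weights are integrals over products of lines, so they do not change when \<open>f\<close> is modified on a
  null set. This allows a Borel density that is bounded everywhere.\<close>

lemma exists_bounded_density:
  assumes f: "integrable lebesgue f" and bd: "\<exists>C. AE x in lebesgue. \<bar>f x\<bar> \<le> C"
  shows "\<exists>g C. bounded_density g C \<and> (AE x in lborel. f x = g x)"
proof -
  obtain C where "AE x in lebesgue. \<bar>f x\<bar> \<le> C" using bd by blast
  then have C: "AE x in lborel. \<bar>f x\<bar> \<le> \<bar>C\<bar>"
    unfolding AE_completion_iff by eventually_elim simp
  obtain g0 where g0[measurable]: "g0 \<in> borel_measurable lborel" and eq: "AE x in lborel. f x = g0 x"
    using completion_ex_borel_measurable_real[OF borel_measurable_integrable[OF f]] by blast
  define g where "g x = (if \<bar>g0 x\<bar> \<le> \<bar>C\<bar> then g0 x else 0)" for x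
  have g[measurable]: "g \<in> borel_measurable lborel" unfolding g_def[abs_def] by measurable
  have fg: "AE x in lborel. f x = g x"
    using C eq by eventually_elim (simp add: g_def)
  have "integrable lebesgue g"
    using f integrable_cong_AE[OF borel_measurable_integrable[OF f] measurable_completion[OF g]
        AE_completion[OF fg]] by blast
  then have "integrable lborel g"
    using integrable_completion[OF g] by simp
  moreover have "\<bar>g x\<bar> \<le> \<bar>C\<bar>" for x by (simp add: g_def)
  ultimately have "bounded_density g \<bar>C\<bar>" using g by unfold_locales simp_all
  with fg show ?thesis by blast
qed

theorem theorem3p2:
  fixes f :: "real \<Rightarrow> real" and c :: real
  assumes "integrable lebesgue f"
    and "\<exists>C. AE x in lebesgue. \<bar>f x\<bar> \<le> C"
    and "isCont f 0 \<longrightarrow> c = f 0"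
  shows "grouplike (R_series f) \<and> grouplike (L_series f) \<and>
    D_series c f = (\<lambda>n. - ribbon_series (\<lambda>\<epsilon>. d_weight c f (\<epsilon> @ [Minus])) n) \<and>
    primitive (D_series c f)"
proof -
  obtain g C where "bounded_density g C" and fg: "AE x in lborel. f x = g x"
    using exists_bounded_density[OF assms(1,2)] by blast
  then interpret bounded_density g C by simp
  have "d_weight c f (\<epsilon> @ [Plus]) = - d_weight c f (\<epsilon> @ [Minus])" for \<epsilon>
    by (simp add: d_weight_def nth_append)
  then have "D_series c f = (\<lambda>n. - ribbon_series (\<lambda>\<epsilon>. d_weight c f (\<epsilon> @ [Minus])) n)"
    by (simp add: D_series_def ribbon_series_def fun_eq_iff sum_negf)
  then show ?thesis
    using grouplike_R_series[OF fg] grouplike_L_series[OF fg] primitive_D_series[OF fg] by blast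
qed

end
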